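(* Let $G$ be a finite simple unmixed graph with at least one vertex, i.e. a graph all of whose minimal vertex covers have the same cardinality. Then for every integer $k\geq 1$, $$k\deg(J(G))\leq \mathrm{reg}(J(G)^{(k)})\leq (k-1)\deg(J(G))+|V(G)|-1.$$
   Context: A vertex cover of $G$ is a subset $C\subseteq V(G)$ meeting every edge of $G$; it is minimal if no proper subset of it is a vertex cover. Let $G$ have vertex set $\{x_1,\ldots,x_n\}$, let $\mathbb{K}$ be a field and $S=\mathbb{K}[x_1,\ldots,x_n]$ (vertices are identified with variables). The cover ideal of $G$ is $$J(G)=\Big(\prod_{x_i\in C}x_i \;\Big|\; C\text{ a minimal vertex cover of }G\Big)=\bigcap_{\{x_i,x_j\}\in E(G)}(x_i,x_j)\subseteq S,$$ and its $k$-th symbolic power is $J(G)^{(k)}=\bigcap_{\{x_i,x_j\}\in E(G)}(x_i,x_j)^k$ (an empty intersection is $S$). For a nonzero monomial ideal $I$, $\deg(I)$ is the maximum degree of a minimal monomial generator of $I$; thus $\deg(J(G))$ is the largest cardinality of a minimal vertex cover of $G$. For a nonzero homogeneous ideal $I\subseteq S$ with graded Betti numbers $\beta_{i,j}(I)$ (from the minimal graded free resolution $\cdots\to\bigoplus_jS(-j)^{\beta_{1,j}(I)}\to\bigoplus_jS(-j)^{\beta_{0,j}(I)}\to I\to 0$ of $I$), the Castelnuovo–Mumford regularity is $\mathrm{reg}(I)=\max\{j-i\mid \beta_{i,j}(I)\neq 0\}$. *)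

theory Defs
  imports "HOL-Library.Poly_Mapping" "Jordan_Normal_Form.Matrix_Kernel"
begin

section \<open>Graphs and vertex covers\<close>

text \<open>
  A finite simple graph is given by its edge set; its vertex set is the (nonempty, finite) type
  \<open>'v\<close>, so isolated vertices are allowed.
\<close>

definition simple_graph :: "'v::finite set set \<Rightarrow> bool" where
  "simple_graph E \<longleftrightarrow> (\<forall>e\<in>E. card e = 2)"

definition vertex_cover :: "'v set set \<Rightarrow> 'v set \<Rightarrow> bool" where
  "vertex_cover E C \<longleftrightarrow> (\<forall>e\<in>E. e \<inter> C \<noteq> {})"

definition minimal_vertex_cover :: "'v set set \<Rightarrow> 'v set \<Rightarrow> bool" where
  "minimal_vertex_cover E C \<longleftrightarrow> vertex_cover E C \<and> \<not> (\<exists>D. D \<subset> C \<and> vertex_cover E D)"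

definition unmixed :: "'v set set \<Rightarrow> bool" where
  "unmixed E \<longleftrightarrow>
     (\<forall>C D. minimal_vertex_cover E C \<longrightarrow> minimal_vertex_cover E D \<longrightarrow> card C = card D)"


section \<open>Polynomials and ideals\<close>

text \<open>
  The polynomial ring over \<open>'k\<close> with one variable for each element of \<open>'v\<close>: a monomial is its
  exponent vector, and multiplication is convolution.
\<close>

type_synonym 'v monom = "'v \<Rightarrow>\<^sub>0 nat"
type_synonym ('v, 'k) mpoly = "'v monom \<Rightarrow>\<^sub>0 'k"

definition monom_poly :: "'v monom \<Rightarrow> ('v, 'k::field) mpoly" where
  "monom_poly m = Poly_Mapping.single m 1"

definition var :: "'v \<Rightarrow> ('v, 'k::field) mpoly" where
  "var x = monom_poly (Poly_Mapping.single x 1)"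

definition monom_degree :: "'v::finite monom \<Rightarrow> nat" where
  "monom_degree m = (\<Sum>x\<in>UNIV. Poly_Mapping.lookup m x)"

text \<open>An ideal is a submodule of the ring, viewed as a module over itself.\<close>

definition ideal_of :: "'r::comm_ring_1 set \<Rightarrow> 'r set" where
  "ideal_of B = Modules.module.span (*) B"

definition ideal_power :: "'r::comm_ring_1 set \<Rightarrow> nat \<Rightarrow> 'r set" where
  "ideal_power I k = ideal_of {\<Prod>i<k. f i | f. \<forall>i<k. f i \<in> I}"

definition maximal_homogeneous_ideal :: "('v, 'k::field) mpoly set" where
  "maximal_homogeneous_ideal = ideal_of (range var)"


section \<open>Cover ideals\<close>

definition cover_ideal :: "'v set set \<Rightarrow> ('v, 'k::field) mpoly set" where
  "cover_ideal E = ideal_of {\<Prod>x\<in>C. var x | C. minimal_vertex_cover E C}"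

text \<open>For \<open>E = {}\<close> the empty intersection is the whole ring.\<close>

definition cover_ideal_symbolic_power :: "'v set set \<Rightarrow> nat \<Rightarrow> ('v, 'k::field) mpoly set" where
  "cover_ideal_symbolic_power E k = (\<Inter>e\<in>E. ideal_power (ideal_of (var ` e)) k)"


section \<open>Degree of a monomial ideal\<close>

definition minimal_monomial_generating_set :: "('v, 'k::field) mpoly set \<Rightarrow> 'v monom set \<Rightarrow> bool"
  where
  "minimal_monomial_generating_set I M \<longleftrightarrow>
     ideal_of (monom_poly ` M) = I \<and> (\<forall>N. N \<subset> M \<longrightarrow> ideal_of (monom_poly ` N) \<noteq> I)"

text \<open>A monomial ideal has exactly one minimal monomial generating set.\<close>

definition minimal_monomial_generators :: "('v, 'k::field) mpoly set \<Rightarrow> 'v monom set" where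
  "minimal_monomial_generators I = (THE M. minimal_monomial_generating_set I M)"

definition monomial_ideal_degree :: "('v::finite, 'k::field) mpoly set \<Rightarrow> nat" where
  "monomial_ideal_degree I = Max (monom_degree ` minimal_monomial_generators I)"


section \<open>Graded Betti numbers and regularity\<close>

text \<open>
  The zero polynomial is homogeneous of every degree, and the only polynomial homogeneous of a
  negative degree.
\<close>

definition homogeneous :: "int \<Rightarrow> ('v::finite, 'k::field) mpoly \<Rightarrow> bool" where
  "homogeneous d p \<longleftrightarrow> (\<forall>m\<in>Poly_Mapping.keys p. int (monom_degree m) = d)"

text \<open>
  Data of a resolution \<open>\<cdots> \<rightarrow> F\<^sub>1 \<rightarrow> F\<^sub>0 \<rightarrow> I \<rightarrow> 0\<close> over the polynomial ring \<open>S\<close>. The list \<open>s i\<close>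
  contains the shifts of \<open>F\<^sub>i\<close>: writing \<open>s i = [d\<^sub>1, \<dots>, d\<^sub>r]\<close>, the module \<open>F\<^sub>i\<close> is
  \<open>S(-d\<^sub>1) \<oplus> \<cdots> \<oplus> S(-d\<^sub>r)\<close>, with basis elements in degrees \<open>d\<^sub>1, \<dots>, d\<^sub>r\<close> and
  elements represented by vectors of length \<open>r\<close>. The matrix \<open>\<phi> i\<close> represents the map
  \<open>F\<^sub>i\<^sub>+\<^sub>1 \<rightarrow> F\<^sub>i\<close>, and \<open>\<epsilon>\<close> is the vector of images in \<open>I\<close> of the basis elements of \<open>F\<^sub>0\<close>.
  The conditions on the entries of \<open>\<epsilon>\<close> and \<open>\<phi> i\<close> say that the maps preserve degrees. Since
  \<open>I \<subseteq> S\<close> lives in nonnegative degrees, so do the generators in its minimal resolution, and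
  natural numbers suffice as shifts.
\<close>

definition graded_free_resolution ::
  "('v::finite, 'k::field) mpoly set \<Rightarrow> (nat \<Rightarrow> nat list) \<Rightarrow> ('v, 'k) mpoly vec \<Rightarrow>
     (nat \<Rightarrow> ('v, 'k) mpoly mat) \<Rightarrow> bool" where
  "graded_free_resolution I s \<epsilon> \<phi> \<longleftrightarrow>
     \<epsilon> \<in> carrier_vec (length (s 0)) \<and>
     (\<forall>b<length (s 0). homogeneous (int (s 0 ! b)) (\<epsilon> $ b)) \<and>
     (\<forall>i. \<phi> i \<in> carrier_mat (length (s i)) (length (s (Suc i)))) \<and>
     (\<forall>i. \<forall>a<length (s i). \<forall>b<length (s (Suc i)).
        homogeneous (int (s (Suc i) ! b) - int (s i ! a)) (\<phi> i $$ (a, b))) \<and>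
     {\<epsilon> \<bullet> v | v. v \<in> carrier_vec (length (s 0))} = I \<and>
     {v \<in> carrier_vec (length (s 0)). \<epsilon> \<bullet> v = 0} =
       {\<phi> 0 *\<^sub>v w | w. w \<in> carrier_vec (length (s 1))} \<and>
     (\<forall>i. mat_kernel (\<phi> i) =
       {\<phi> (Suc i) *\<^sub>v w | w. w \<in> carrier_vec (length (s (Suc (Suc i))))})"

definition minimal_graded_free_resolution ::
  "('v::finite, 'k::field) mpoly set \<Rightarrow> (nat \<Rightarrow> nat list) \<Rightarrow> ('v, 'k) mpoly vec \<Rightarrow>
     (nat \<Rightarrow> ('v, 'k) mpoly mat) \<Rightarrow> bool" where
  "minimal_graded_free_resolution I s \<epsilon> \<phi> \<longleftrightarrow>
     graded_free_resolution I s \<epsilon> \<phi> \<and>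
     (\<forall>i. \<forall>a<length (s i). \<forall>b<length (s (Suc i)).
        \<phi> i $$ (a, b) \<in> maximal_homogeneous_ideal)"

text \<open>
  \<open>graded_betti I i j\<close> is the number of summands \<open>S(-j)\<close> of \<open>F\<^sub>i\<close>. Every homogeneous ideal has a
  minimal graded free resolution, and any two of them are isomorphic, so the choice is immaterial.
\<close>

definition graded_betti :: "('v::finite, 'k::field) mpoly set \<Rightarrow> nat \<Rightarrow> nat \<Rightarrow> nat" where
  "graded_betti I =
     (SOME \<beta>. \<exists>s \<epsilon> \<phi>. minimal_graded_free_resolution I s \<epsilon> \<phi> \<and>
        (\<forall>i j. \<beta> i j = count_list (s i) j))"

definition regularity :: "('v::finite, 'k::field) mpoly set \<Rightarrow> int" where
  "regularity I = Max {int j - int i | i j. graded_betti I i j \<noteq> 0}"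

end

theory Submission
  imports Defs "HOL-Library.Function_Algebras"
begin

text \<open>
  A monomial lies in \<open>J(G)\<^sup>(\<^sup>k\<^sup>)\<close> iff its exponent vector \<open>m\<close> is a \<open>k\<close>-cover: \<open>m\<^sub>x + m\<^sub>y \<ge> k\<close> on every
  edge. If \<open>C\<close> is a minimal vertex cover, then \<open>k\<close> times its indicator vector is a minimal \<open>k\<close>-cover,
  hence a minimal generator of degree \<open>k deg J(G)\<close>. For the upper bound, a summand \<open>S(-j)\<close> of \<open>F\<^sub>i\<close>
  forces nonzero Koszul homology in homological degree \<open>i\<close> and in some multidegree \<open>a\<close> of total degree
  \<open>j\<close>. The Koszul complex in multidegree \<open>a\<close> is acyclic as soon as the simplicial complex
  \<open>{F. x\<^bsup>a - F\<^esup> \<in> J(G)\<^sup>(\<^sup>k\<^sup>)}\<close> has a cone point. If it has none, then it has a facet \<open>F\<close> that is independent in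
  \<open>G\<close>, and \<open>a - F\<close> is a minimal \<open>k\<close>-cover. On an unmixed graph minimal \<open>k\<close>-covers have weight at most
  \<open>k deg J(G)\<close>, so \<open>j \<le> k deg J(G) + |F| \<le> (k - 1) deg J(G) + |V(G)|\<close>. This suffices for
  \<open>i \<ge> 1\<close>; for \<open>i = 0\<close> the set \<open>F\<close> is empty and \<open>deg J(G) \<le> |V(G)| - 1\<close>.
\<close>

section \<open>Polynomials\<close>

text \<open>Why minimal \<open>k\<close>-covers \<open>c\<close> are light on an unmixed graph: the
  weight is the sum of the sizes of the level sets \<open>{x. t \<le> c x}\<close>, and the levels
  \<open>s\<close> and \<open>t\<close> with \<open>s + t = k + 1\<close>, \<open>s \<le> t\<close>,
  are estimated together. The vertices with \<open>c x < s\<close> are independent, have no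
  neighbour in the band \<open>s \<le> c x < t\<close>, and dominate everything above it. Together
  with any maximal independent set of the band they form a maximal independent set of the graph.
  Unmixedness therefore passes to the band, which has no isolated vertices, and an exchange argument
  of Hall type shows that its independent sets fill at most half of it. The other obstacle is the
  regularity itself: a maximum over Betti numbers of a chosen resolution, which must first be shown
  to exist. The vanishing that yields the upper bound also settles this. Vanishing in high degrees
  makes all syzygy modules finitely generated, taking the place of the basis theorem, and vanishing
  in homological degrees above \<open>|V|\<close> makes the maximum range over a finite set.
  Shifting along the resolution relates its basis elements to Koszul homology.\<close>

abbreviation coef :: "('v, 'k::field) mpoly \<Rightarrow> 'v monom \<Rightarrow> 'k" where
  "coef \<equiv> Poly_Mapping.lookup"

abbreviation supp :: "('v, 'k::field) mpoly \<Rightarrow> 'v monom set" where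
  "supp \<equiv> Poly_Mapping.keys"

abbreviation expo :: "'v monom \<Rightarrow> 'v \<Rightarrow> nat" where
  "expo \<equiv> Poly_Mapping.lookup"

abbreviation var_monom :: "'v \<Rightarrow> 'v monom" where
  "var_monom x \<equiv> Poly_Mapping.single x 1"

lemma coef_single_times: "coef (Poly_Mapping.single t c * p) (t + b) = c * coef p b"
  by (simp add: lookup_mult lookup_single when_mult)

lemma coef_single_times_eq_0:
  assumes "\<And>b. m \<noteq> t + b"
  shows "coef (Poly_Mapping.single t c * p) m = 0"
  using assms by (simp add: lookup_mult lookup_single when_mult)

lemma var_monom_plus_minus: "expo b x \<noteq> 0 \<Longrightarrow> var_monom x + (b - var_monom x) = b"
  by (rule poly_mapping_eqI) (auto simp: lookup_add lookup_minus lookup_single when_def)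

lemma coef_var_times:
  "coef (var x * p) b = (if expo b x = 0 then 0 else coef p (b - var_monom x))"
proof (cases "expo b x = 0")
  case True
  have "b \<noteq> var_monom x + c" for c
    using True by (metis add_is_0 lookup_add lookup_single_eq zero_neq_one)
  with True show ?thesis
    by (simp add: var_def monom_poly_def coef_single_times_eq_0)
next
  case False
  then show ?thesis
    using coef_single_times[of "var_monom x" 1 p "b - var_monom x"] var_monom_plus_minus[of b x]
    by (simp add: var_def monom_poly_def)
qed

lemma monom_degree_add: "monom_degree (a + b) = monom_degree a + monom_degree b"
  by (simp add: monom_degree_def lookup_add sum.distrib)

lemma monom_degree_single [simp]: "monom_degree (Poly_Mapping.single x c) = c"
  by (simp add: monom_degree_def lookup_single when_def sum.delta)

lemma monom_degree_0 [simp]: "monom_degree 0 = 0"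
  by (simp add: monom_degree_def)

lemma monom_degree_eq_0_iff [simp]: "monom_degree m = 0 \<longleftrightarrow> m = 0"
  by (auto simp: monom_degree_def intro: poly_mapping_eqI)

lemma finite_monoms_of_degree: "finite {m :: 'v::finite monom. monom_degree m = d}"
proof (rule finite_imageD)
  have "expo m x \<le> d" if "monom_degree m = d" for m :: "'v monom" and x
    using that member_le_sum[of x UNIV "expo m"] by (simp add: monom_degree_def)
  then have "expo ` {m :: 'v monom. monom_degree m = d} \<subseteq> {f. \<forall>x. f x \<in> {..d}}"
    by auto
  moreover have "finite {f :: 'v \<Rightarrow> nat. \<forall>x. f x \<in> {..d}}"
    using finite_PiE[of "UNIV :: 'v set" "\<lambda>_. {..d}"] by (simp add: PiE_def Pi_def)
  ultimately show "finite (expo ` {m :: 'v monom. monom_degree m = d})"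
    by (rule finite_subset)
  show "inj_on expo {m :: 'v monom. monom_degree m = d}"
    by (intro inj_onI) (metis poly_mapping_eqI)
qed

lemma homogeneous_0 [simp]: "homogeneous d 0"
  by (simp add: homogeneous_def)

lemma homogeneousD: "homogeneous d p \<Longrightarrow> coef p m \<noteq> 0 \<Longrightarrow> int (monom_degree m) = d"
  by (simp add: homogeneous_def in_keys_iff)

lemma homogeneous_add: "homogeneous d p \<Longrightarrow> homogeneous d q \<Longrightarrow> homogeneous d (p + q)"
  using keys_add[of p q] by (auto simp: homogeneous_def)

lemma homogeneous_sum: "(\<And>i. i \<in> I \<Longrightarrow> homogeneous d (f i)) \<Longrightarrow> homogeneous d (sum f I)"
  by (induction I rule: infinite_finite_induct) (auto intro: homogeneous_add)

lemma homogeneous_diff: "homogeneous d p \<Longrightarrow> homogeneous d q \<Longrightarrow> homogeneous d (p - q)"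
  by (auto simp: homogeneous_def in_keys_iff lookup_minus)

lemma homogeneous_mult:
  "homogeneous d p \<Longrightarrow> homogeneous e q \<Longrightarrow> homogeneous (d + e) (p * q)"
  using keys_mult[of p q] by (fastforce simp: homogeneous_def monom_degree_add)

lemma homogeneous_var: "homogeneous 1 (var x)"
  by (simp add: homogeneous_def var_def monom_poly_def)

section \<open>Homogeneous components of polynomials\<close>

definition hcomp :: "int \<Rightarrow> ('v::finite, 'k::field) mpoly \<Rightarrow> ('v, 'k) mpoly" where
  "hcomp d p = (\<Sum>m \<in> {m \<in> supp p. int (monom_degree m) = d}. Poly_Mapping.single m (coef p m))"

lemma coef_hcomp: "coef (hcomp d p) m = (if int (monom_degree m) = d then coef p m else 0)"
  by (auto simp: hcomp_def lookup_sum lookup_single when_def sum.delta' in_keys_iff)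

lemma hcomp_add: "hcomp d (p + q) = hcomp d p + hcomp d q"
  by (rule poly_mapping_eqI) (simp add: coef_hcomp lookup_add)

lemma hcomp_0 [simp]: "hcomp d 0 = 0"
  by (rule poly_mapping_eqI) (simp add: coef_hcomp)

lemma hcomp_sum: "hcomp d (sum f I) = (\<Sum>i\<in>I. hcomp d (f i))"
  by (induction I rule: infinite_finite_induct) (auto simp: hcomp_add)

lemma homogeneous_hcomp: "homogeneous d (hcomp d p)"
  by (auto simp: homogeneous_def in_keys_iff coef_hcomp split: if_splits)

lemma hcomp_homogeneous: "homogeneous d p \<Longrightarrow> hcomp e p = (if e = d then p else 0)"
  by (rule poly_mapping_eqI) (auto simp: coef_hcomp dest: homogeneousD)

lemma sum_single_keys: "(\<Sum>m\<in>supp p. Poly_Mapping.single m (Poly_Mapping.lookup p m)) = p"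
  by (rule poly_mapping_eqI) (simp add: lookup_sum lookup_single when_def sum.delta' in_keys_iff)

lemma sum_hcomp: "(\<Sum>d\<in>(\<lambda>m. int (monom_degree m)) ` supp p. hcomp d p) = p"
  by (rule poly_mapping_eqI) (auto simp: lookup_sum coef_hcomp sum.delta' in_keys_iff)

lemma hcomp_mult_left:
  assumes "homogeneous e q"
  shows "hcomp d (q * p) = q * hcomp (d - e) p"
proof -
  let ?D = "(\<lambda>m. int (monom_degree m)) ` supp p"
  have *: "hcomp d (q * hcomp c p) = (if c = d - e then q * hcomp c p else 0)" for c
    using hcomp_homogeneous[OF homogeneous_mult[OF assms homogeneous_hcomp[of c p]], of d] by auto
  have "hcomp d (q * p) = hcomp d (q * (\<Sum>c\<in>?D. hcomp c p))"
    by (simp add: sum_hcomp)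
  also have "\<dots> = (\<Sum>c\<in>?D. hcomp d (q * hcomp c p))"
    by (simp add: sum_distrib_left hcomp_sum)
  also have "\<dots> = (\<Sum>c\<in>?D. if d - e = c then q * hcomp c p else 0)"
    by (intro sum.cong) (auto simp: *)
  also have "\<dots> = (if d - e \<in> ?D then q * hcomp (d - e) p else 0)"
    by (subst sum.delta') auto
  also have "\<dots> = q * hcomp (d - e) p"
  proof (cases "d - e \<in> ?D")
    case False
    then have "hcomp (d - e) p = 0"
      by (intro poly_mapping_eqI) (force simp: coef_hcomp in_keys_iff image_iff)
    then show ?thesis by simp
  qed simp
  finally show ?thesis .
qed

section \<open>Ideals and monomials\<close>

lemma module_ring: "Modules.module ((*) :: 'r::comm_ring_1 \<Rightarrow> 'r \<Rightarrow> 'r)"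
  by unfold_locales (simp_all add: algebra_simps)

lemma ideal_of_mult: "p \<in> ideal_of B \<Longrightarrow> r * p \<in> ideal_of B"
  and ideal_of_base: "p \<in> B \<Longrightarrow> p \<in> ideal_of B"
  and ideal_of_sum: "(\<And>i. i \<in> I \<Longrightarrow> f i \<in> ideal_of B) \<Longrightarrow> sum f I \<in> ideal_of B"
  unfolding ideal_of_def
  by (simp_all add: Modules.module.span_scale[OF module_ring] Modules.module.span_base[OF module_ring]
      Modules.module.span_sum[OF module_ring])

text \<open>The exponent sets of monomial ideals.\<close>

definition monomial_set :: "'v monom set \<Rightarrow> bool" where
  "monomial_set U \<longleftrightarrow> (\<forall>m\<in>U. \<forall>n. m + n \<in> U)"

lemma monomial_set_divisible: "monomial_set {m. \<exists>n\<in>M. \<exists>r. m = n + r}"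
  by (auto simp: monomial_set_def) (metis add.assoc)

text \<open>The polynomials supported in \<open>U\<close> form an ideal, since multiplication only
  moves exponents upwards.\<close>

lemma ideal_subset_monomial:
  assumes "monomial_set U" "\<And>b. b \<in> B \<Longrightarrow> supp b \<subseteq> U" "p \<in> ideal_of B"
  shows "supp (p :: ('v, 'k::field) mpoly) \<subseteq> U"
proof -
  have "ideal_of B \<subseteq> {p. supp p \<subseteq> U}"
    unfolding ideal_of_def
  proof (rule Modules.module.span_minimal[OF module_ring])
    show "Modules.module.subspace (*) {p :: ('v, 'k) mpoly. supp p \<subseteq> U}"
    proof (rule Modules.module.subspaceI[OF module_ring])
      fix p q :: "('v, 'k) mpoly"
      assume p: "p \<in> {p. supp p \<subseteq> U}"
      show "q * p \<in> {p. supp p \<subseteq> U}"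
      proof -
        have "a + b \<in> U" if "b \<in> supp p" for a b
          using that p assms(1) add.commute[of a b] by (auto simp: monomial_set_def)
        then show ?thesis
          using keys_mult[of q p] by auto
      qed
      assume "q \<in> {p. supp p \<subseteq> U}"
      with p show "p + q \<in> {p. supp p \<subseteq> U}"
        using keys_add[of p q] by auto
    qed simp
  qed (use assms in auto)
  with assms(3) show ?thesis by auto
qed

lemma monom_poly_add: "monom_poly (a + b) = monom_poly a * monom_poly b"
  by (simp add: monom_poly_def mult_single)

lemma single_eq_monom_poly: "Poly_Mapping.single m c = Poly_Mapping.single 0 c * monom_poly m"
  by (simp add: monom_poly_def mult_single)

lemma monomial_subset_ideal:
  fixes p :: "('v, 'k::field) mpoly"
  assumes "\<And>m. m \<in> supp p \<Longrightarrow> monom_poly m \<in> ideal_of B"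
  shows "p \<in> ideal_of B"
proof -
  have "(\<Sum>m\<in>supp p. Poly_Mapping.single m (coef p m)) \<in> ideal_of B"
  proof (rule ideal_of_sum)
    fix m assume "m \<in> supp p"
    then show "Poly_Mapping.single m (coef p m) \<in> ideal_of B"
      by (subst single_eq_monom_poly) (rule ideal_of_mult[OF assms])
  qed
  then show ?thesis
    by (simp add: sum_single_keys)
qed

lemma in_monomial_ideal_iff:
  fixes p :: "('v, 'k::field) mpoly"
  shows "p \<in> ideal_of (monom_poly ` M) \<longleftrightarrow> supp p \<subseteq> {m. \<exists>n\<in>M. \<exists>r. m = n + r}"
proof
  assume "p \<in> ideal_of (monom_poly ` M)"
  then show "supp p \<subseteq> {m. \<exists>n\<in>M. \<exists>r. m = n + r}"
  proof (rule ideal_subset_monomial[OF monomial_set_divisible, rotated])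
    fix b :: "('v, 'k) mpoly"
    assume "b \<in> monom_poly ` M"
    then show "supp b \<subseteq> {m. \<exists>n\<in>M. \<exists>r. m = n + r}"
      by (auto simp: monom_poly_def intro!: exI[of _ 0])
  qed
next
  assume p: "supp p \<subseteq> {m. \<exists>n\<in>M. \<exists>r. m = n + r}"
  show "p \<in> ideal_of (monom_poly ` M)"
  proof (rule monomial_subset_ideal)
    fix m assume "m \<in> supp p"
    with p obtain n r where "n \<in> M" "m = r + n" by (auto simp: add.commute)
    then show "monom_poly m \<in> ideal_of (monom_poly ` M)"
      by (simp add: monom_poly_add ideal_of_mult ideal_of_base)
  qed
qed

lemma monom_poly_in_monomial_ideal_iff:
  "(monom_poly m :: ('v, 'k::field) mpoly) \<in> ideal_of (monom_poly ` M) \<longleftrightarrow> (\<exists>n\<in>M. \<exists>r. m = n + r)"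
  by (subst in_monomial_ideal_iff) (auto simp: monom_poly_def)

lemma nonzero_eq_var_monom_add: "m \<noteq> 0 \<Longrightarrow> \<exists>x r. m = var_monom x + r"
  by (metis lookup_zero poly_mapping_eqI var_monom_plus_minus)

lemma maximal_homogeneous_ideal_iff:
  fixes p :: "('v, 'k::field) mpoly"
  shows "p \<in> maximal_homogeneous_ideal \<longleftrightarrow> coef p 0 = 0"
proof -
  have "(maximal_homogeneous_ideal :: ('v, 'k) mpoly set) = ideal_of (monom_poly ` range var_monom)"
    by (simp add: maximal_homogeneous_ideal_def image_image var_def)
  from arg_cong[where f = "\<lambda>I. p \<in> I", OF this]
  have "p \<in> maximal_homogeneous_ideal \<longleftrightarrow> supp p \<subseteq> {m. \<exists>n\<in>range var_monom. \<exists>r. m = n + r}"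
    unfolding in_monomial_ideal_iff .
  also have "{m :: 'v monom. \<exists>n\<in>range var_monom. \<exists>r. m = n + r} = - {0}"
  proof -
    have "expo (var_monom x + r) x \<noteq> expo 0 x" for x and r :: "'v monom"
      by (simp add: lookup_add)
    then have "0 \<noteq> var_monom x + r" for x and r :: "'v monom"
      by metis
    then show ?thesis
      using nonzero_eq_var_monom_add by (auto simp del: One_nat_def)
  qed
  also have "supp p \<subseteq> - {0} \<longleftrightarrow> coef p 0 = 0"
    by (auto simp: in_keys_iff)
  finally show ?thesis .
qed

section \<open>Koszul complexes\<close>

text \<open>An arbitrary numbering of the variables that fixes the order of exterior factors, and
  with it every Koszul sign.\<close>

definition vnum :: "'v::finite \<Rightarrow> nat" where
  "vnum = (SOME f. inj f)"

lemma inj_vnum: "inj (vnum :: 'v::finite \<Rightarrow> nat)"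
proof -
  have "\<exists>f :: 'v \<Rightarrow> nat. inj f"
    using finite_imp_inj_to_nat_seg[of "UNIV :: 'v set"] by auto
  then show ?thesis
    unfolding vnum_def by (rule someI_ex)
qed

text \<open>The sign of moving \<open>x\<close> to its place among the exterior factors of
  \<open>G\<close>.\<close>

definition ksign :: "'v::finite \<Rightarrow> 'v set \<Rightarrow> 'r::comm_ring_1" where
  "ksign x G = (-1) ^ card {y \<in> G. vnum y < vnum x}"

lemma ksign_mult_self: "ksign x G * ksign x G = 1"
  by (simp add: ksign_def flip: power_add mult_2)

lemma ksign_insert:
  assumes "y \<notin> G"
  shows "ksign x (insert y G) = (if vnum y < vnum x then - ksign x G else ksign x G)"
proof -
  have "{z \<in> insert y G. vnum z < vnum x} =
      (if vnum y < vnum x then insert y {z \<in> G. vnum z < vnum x} else {z \<in> G. vnum z < vnum x})"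
    by auto
  with assms show ?thesis
    by (simp add: ksign_def)
qed

text \<open>The vertex with the smaller number is counted in the sign of the other one, and not
  conversely, so exactly one of the two factors changes sign.\<close>

lemma ksign_swap:
  assumes "x \<noteq> y" "x \<notin> G" "y \<notin> G"
  shows "ksign y (insert x G) * ksign x (insert y G) = - (ksign x G * ksign y G)"
proof -
  have "vnum x \<noteq> vnum y"
    using inj_vnum assms(1) by (metis injD)
  with assms show ?thesis
    by (auto simp: ksign_insert mult.commute)
qed

lemma homogeneous_ksign_times:
  fixes p :: "('v::finite, 'k::field) mpoly"
  shows "homogeneous d p \<Longrightarrow> homogeneous d (ksign x G * p)"
proof -
  have "homogeneous d ((-1) ^ n * p)" if "homogeneous d p" for n
    using that by (induction n) (auto simp: homogeneous_def)
  then show "homogeneous d p \<Longrightarrow> homogeneous d (ksign x G * p)"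
    by (simp add: ksign_def)
qed

lemma coef_ksign_times:
  fixes p :: "('v::finite, 'k::field) mpoly"
  shows "coef (ksign x G * p) b = ksign x G * coef p b"
proof -
  have "coef ((-1) ^ n * p) b = (-1) ^ n * coef p b" for n
    by (induction n) auto
  then show ?thesis
    by (simp add: ksign_def)
qed

text \<open>The Koszul differential. A chain is stored as the function sending \<open>G\<close> to
  the coefficient of the exterior monomial on \<open>G\<close>. All homological degrees share one
  type; degree \<open>p\<close> is imposed by \<open>c G = 0\<close> unless
  \<open>card G = p\<close>.\<close>

definition kbd :: "('v::finite set \<Rightarrow> ('v, 'k::field) mpoly) \<Rightarrow> 'v set \<Rightarrow> ('v, 'k) mpoly" where
  "kbd c G = (\<Sum>x\<in>-G. ksign x G * (var x * c (insert x G)))"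

lemma kbd_0 [simp]: "kbd (\<lambda>_. 0) G = 0"
  by (simp add: kbd_def)

lemma kbd_diff: "kbd (\<lambda>G. c G - c' G) G = kbd c G - kbd c' G"
  by (simp add: kbd_def algebra_simps sum_subtractf)

lemma kbd_linear_combination:
  "kbd (\<lambda>G. \<Sum>b\<in>I. r b * c b G) G = (\<Sum>b\<in>I. r b * kbd (c b) G)"
  unfolding kbd_def sum_distrib_left
  by (subst sum.swap) (simp add: algebra_simps)

text \<open>Deleting two exterior factors in either order gives the same term with opposite signs,
  so the sum over ordered pairs cancels.\<close>

lemma kbd_kbd:
  fixes c :: "'v::finite set \<Rightarrow> ('v, 'k::field) mpoly"
  shows "kbd (kbd c) G = 0"
proof -
  define f where "f x y = ksign x G * (var x * (ksign y (insert x G) * (var y * c (insert y (insert x G)))))"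
    for x y
  let ?A = "SIGMA x:-G. - insert x G"
  let ?L = "{(x, y) \<in> ?A. vnum x < vnum y}" and ?R = "{(x, y) \<in> ?A. vnum y < vnum x}"
  have anti: "f x y + f y x = 0" if "x \<noteq> y" "x \<notin> G" "y \<notin> G" for x y
  proof -
    have s: "ksign y (insert x G) = - (ksign x G * ksign y G * ksign x (insert y G))"
    proof -
      have "ksign y (insert x G) = ksign y (insert x G) * (ksign x (insert y G) * ksign x (insert y G))"
        by (simp add: ksign_mult_self)
      also have "\<dots> = - (ksign x G * ksign y G) * ksign x (insert y G)"
        by (simp only: ksign_swap[OF that] flip: mult.assoc)
      finally show ?thesis by simp
    qed
    have "f x y = - ((ksign x G * ksign x G) *
        (ksign y G * (var y * (ksign x (insert y G) * (var x * c (insert x (insert y G)))))))"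
      unfolding f_def s by (simp add: insert_commute mult_ac)
    then show ?thesis
      by (simp add: ksign_mult_self f_def)
  qed
  have "kbd (kbd c) G = (\<Sum>(x, y)\<in>?A. f x y)"
    by (simp add: kbd_def f_def sum_distrib_left sum.Sigma)
  also have "?A = ?L \<union> ?R"
  proof -
    have "vnum x < vnum y \<or> vnum y < vnum x" if "x \<noteq> y" for x y :: 'v
      using that by (metis inj_vnum injD linorder_neqE_nat)
    then show ?thesis
      by blast
  qed
  also have "(\<Sum>(x, y)\<in>\<dots>. f x y) = (\<Sum>(x, y)\<in>?L. f x y) + (\<Sum>(x, y)\<in>?R. f x y)"
    by (rule sum.union_disjoint) auto
  also have "(\<Sum>(x, y)\<in>?R. f x y) = (\<Sum>(x, y)\<in>?L. f y x)"
    by (rule sum.reindex_bij_witness[where i = prod.swap and j = prod.swap]) auto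
  also have "(\<Sum>(x, y)\<in>?L. f x y) + \<dots> = (\<Sum>(x, y)\<in>?L. f x y + f y x)"
    by (simp add: sum.distrib case_prod_unfold)
  also have "\<dots> = 0"
    by (rule sum.neutral) (auto simp: anti)
  finally show ?thesis .
qed

section \<open>Contraction of the Koszul complex, multidegree by multidegree\<close>

definition set_monom :: "'v set \<Rightarrow> 'v monom" where
  "set_monom F = (\<Sum>x\<in>F. var_monom x)"

lemma expo_set_monom: "expo (set_monom F) x = (if x \<in> F then 1 else 0)" for F :: "'v::finite set"
  by (simp add: set_monom_def lookup_sum lookup_single when_def sum.delta')

lemma set_monom_insert: "x \<notin> F \<Longrightarrow> set_monom (insert x F) = var_monom x + set_monom F"
  for F :: "'v::finite set"
  by (simp add: set_monom_def)

lemma monom_degree_set_monom: "monom_degree (set_monom F) = card F" for F :: "'v::finite set"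
  by (simp add: monom_degree_def expo_set_monom sum.If_cases)

text \<open>The differential preserves the multidegree \<open>a = b + set_monom G\<close>, so a
  vertex \<open>\<xi> a\<close> can be chosen for each \<open>a\<close> independently. The chain
  \<open>w\<close> inserts that vertex as an exterior factor; on a cycle the homotopy identity
  \<open>dh + hd = 1\<close> becomes \<open>kbd w = c\<close>. The hypothesis \<open>cone\<close>
  says that a vertex still to be inserted divides the coefficient monomial.\<close>

lemma kbd_contraction:
  fixes c :: "'v::finite set \<Rightarrow> ('v, 'k::field) mpoly" and \<xi> :: "'v monom \<Rightarrow> 'v"
  assumes cycle: "\<And>G. kbd c G = 0"
    and cone: "\<And>F b. b \<in> supp (c F) \<Longrightarrow> \<xi> (b + set_monom F) \<notin> F \<Longrightarrow> expo b (\<xi> (b + set_monom F)) \<noteq> 0"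
  obtains w where
    "\<And>G b. coef (w G) b = (let x = \<xi> (b + set_monom G) in
       if x \<in> G then ksign x (G - {x}) * coef (c (G - {x})) (b + var_monom x) else 0)"
    and "kbd w = c"
proof -
  define h where "h G b = (let x = \<xi> (b + set_monom G) in
       if x \<in> G then ksign x (G - {x}) * coef (c (G - {x})) (b + var_monom x) else 0)" for G b
  define w where "w G = Abs_poly_mapping (h G)" for G
  have "finite {b. h G b \<noteq> 0}" for G
  proof (rule finite_subset)
    show "{b. h G b \<noteq> 0} \<subseteq> (\<Union>x\<in>G. (\<lambda>m. m - var_monom x) ` supp (c (G - {x})))"
    proof
      fix b assume "b \<in> {b. h G b \<noteq> 0}"
      then obtain x where "x \<in> G" "b + var_monom x \<in> supp (c (G - {x}))"
        by (auto simp: h_def Let_def in_keys_iff split: if_splits)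
      moreover have "b = (b + var_monom x) - var_monom x"
        by simp
      ultimately show "b \<in> (\<Union>x\<in>G. (\<lambda>m. m - var_monom x) ` supp (c (G - {x})))"
        by blast
    qed
  qed auto
  then have w: "coef (w G) b = h G b" for G b
    by (simp add: w_def)
  have "coef (kbd w G) b = coef (c G) b" for G b
  proof -
    define x where "x = \<xi> (b + set_monom G)"
    \<comment> \<open>Moving \<open>y\<close> from the monomial to the exterior factor keeps the
      multidegree, so all summands of the differential use the same vertex \<open>x\<close>.\<close>
    have a: "b - var_monom y + set_monom (insert y G) = b + set_monom G"
      if "y \<notin> G" "expo b y \<noteq> 0" for y
    proof -
      have "b - var_monom y + set_monom (insert y G) = var_monom y + (b - var_monom y) + set_monom G"
        by (simp only: set_monom_insert[OF that(1)] ac_simps)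
      then show ?thesis
        by (simp only: var_monom_plus_minus[OF that(2)])
    qed
    have "coef (kbd w G) b = (\<Sum>y\<in>-G. ksign y G *
        (if expo b y = 0 then 0 else h (insert y G) (b - var_monom y)))"
      by (simp add: kbd_def lookup_sum coef_ksign_times coef_var_times w cong: if_cong)
    also have "\<dots> = (\<Sum>y\<in>-G. if expo b y = 0 then 0 else if x \<in> insert y G then ksign y G *
        (ksign x (insert y G - {x}) * coef (c (insert y G - {x})) (b - var_monom y + var_monom x)) else 0)"
      by (intro sum.cong refl) (auto simp: h_def a x_def[symmetric] Let_def simp del: One_nat_def)
    also have "\<dots> = coef (c G) b"
    proof (cases "x \<in> G")
      \<comment> \<open>Only the summand \<open>y = x\<close> survives. Where \<open>x\<close> does
        not divide \<open>b\<close>, the coefficient of \<open>c G\<close> at \<open>b\<close>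
        vanishes by \<open>cone\<close>.\<close>
      case False
      have "(\<Sum>y\<in>-G. if expo b y = 0 then 0 else if x \<in> insert y G then ksign y G *
        (ksign x (insert y G - {x}) * coef (c (insert y G - {x})) (b - var_monom y + var_monom x)) else 0)
        = (\<Sum>y\<in>-G. if y = x then if expo b x = 0 then 0 else coef (c G) b else 0)"
      proof (intro sum.cong refl)
        fix y assume "y \<in> - G"
        have "b - var_monom x + var_monom x = b" if "expo b x \<noteq> 0"
          using var_monom_plus_minus[OF that] by (simp add: add.commute)
        then show "(if expo b y = 0 then 0 else if x \<in> insert y G then ksign y G *
          (ksign x (insert y G - {x}) * coef (c (insert y G - {x})) (b - var_monom y + var_monom x)) else 0)
          = (if y = x then if expo b x = 0 then 0 else coef (c G) b else 0)"
          using False by (auto simp: ksign_mult_self simp flip: mult.assoc simp del: One_nat_def)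
      qed
      also have "\<dots> = (if expo b x = 0 then 0 else coef (c G) b)"
        using False by (simp add: sum.delta)
      also have "\<dots> = coef (c G) b"
        using cone[of b G] False by (cases "coef (c G) b = 0") (auto simp: x_def in_keys_iff)
      finally show ?thesis .
    next
      case True
      \<comment> \<open>The cycle condition at \<open>H\<close>, read at the monomial
        \<open>b + var_monom x\<close>, contains the coefficient of \<open>c G\<close> at
        \<open>b\<close> once; solving for it gives the summands of \<open>kbd w G\<close> up to the
        sign rule \<open>ksign_swap\<close>.\<close>
      define H where "H = G - {x}"
      have G: "G = insert x H" "x \<notin> H"
        using True by (auto simp: H_def)
      have e: "expo (b + var_monom x) y = (if y = x then Suc (expo b y) else expo b y)" for y
        by (simp add: lookup_add lookup_single when_def)
      have r: "b + var_monom x - var_monom y = b - var_monom y + var_monom x"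
        if "expo b y \<noteq> 0" "y \<noteq> x" for y
        using that by (intro poly_mapping_eqI) (auto simp: lookup_add lookup_minus lookup_single when_def)
      have "0 = coef (kbd c H) (b + var_monom x)"
        by (simp add: cycle)
      also have "\<dots> = (\<Sum>y\<in>-H. ksign y H * (if expo (b + var_monom x) y = 0 then 0
          else coef (c (insert y H)) (b + var_monom x - var_monom y)))"
        by (simp add: kbd_def lookup_sum coef_ksign_times coef_var_times cong: if_cong)
      also have "-H = insert x (-G)"
        using G by auto
      also have "(\<Sum>y\<in>insert x (-G). ksign y H * (if expo (b + var_monom x) y = 0 then 0
          else coef (c (insert y H)) (b + var_monom x - var_monom y))) =
          ksign x H * coef (c G) b + (\<Sum>y\<in>-G. ksign y H * (if expo (b + var_monom x) y = 0 then 0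
          else coef (c (insert y H)) (b + var_monom x - var_monom y)))"
        using True by (subst sum.insert) (simp_all add: G(1)[symmetric] e del: One_nat_def)
      finally have 1: "coef (c G) b = - ksign x H * (\<Sum>y\<in>-G. ksign y H * (if expo (b + var_monom x) y = 0 then 0
          else coef (c (insert y H)) (b + var_monom x - var_monom y)))" (is "_ = - _ * ?S")
      proof -
        assume "0 = ksign x H * coef (c G) b + ?S"
        from this[symmetric] have "ksign x H * coef (c G) b = - ?S"
          by (rule eq_neg_iff_add_eq_0[THEN iffD2])
        then have "ksign x H * (ksign x H * coef (c G) b) = - ksign x H * ?S"
          by simp
        then show ?thesis
          by (simp add: ksign_mult_self flip: mult.assoc)
      qed
      show ?thesis
        unfolding 1 sum_distrib_left
      proof (intro sum.cong refl)
        fix y assume "y \<in> - G"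
        then have y: "y \<noteq> x" "y \<notin> H" "y \<notin> G" "insert y G - {x} = insert y H"
          using G by auto
        have "ksign y (insert x H) * ksign x (insert y H) = - (ksign x H * ksign y H :: 'k)"
          using y G by (intro ksign_swap) auto
        from arg_cong[OF this, of "\<lambda>u. u * _"]
        have "ksign y G * (ksign x (insert y H) * z) = - (ksign x H * (ksign y H * z))" for z :: 'k
          unfolding G(1) by (simp add: mult.assoc)
        then show "(if expo b y = 0 then 0 else if x \<in> insert y G then ksign y G *
          (ksign x (insert y G - {x}) * coef (c (insert y G - {x})) (b - var_monom y + var_monom x)) else 0)
          = - ksign x H * (ksign y H * (if expo (b + var_monom x) y = 0 then 0
          else coef (c (insert y H)) (b + var_monom x - var_monom y)))"
          using y True r[of y] by (simp add: e del: One_nat_def)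
      qed
    qed
    finally show ?thesis .
  qed
  then have "kbd w = c"
    by (intro ext poly_mapping_eqI)
  with that[of w] w show thesis
    by (simp add: h_def)
qed

text \<open>Coefficients of degree \<open>d\<close> on \<open>p\<close> exterior factors give
  multidegrees of total degree \<open>d + p\<close>. A vertex by which every face of size
  \<open>p\<close> in the complex of \<open>a\<close> can be extended serves as the contracting
  vertex, and extendability is what keeps the contracted chain inside \<open>U\<close>.\<close>

lemma koszul_exact_monomial:
  fixes c :: "'v::finite set \<Rightarrow> ('v, 'k::field) mpoly"
  assumes cycle: "\<And>G. kbd c G = 0"
    and chain: "\<And>G. card G \<noteq> p \<Longrightarrow> c G = 0"
    and supp: "\<And>G. supp (c G) \<subseteq> U"
    and hom: "\<And>G. homogeneous d (c G)"
    and cone: "\<And>a. int (monom_degree a) = d + int p \<Longrightarrow>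
      \<exists>x. \<forall>F b. card F = p \<longrightarrow> a = b + set_monom F \<longrightarrow> b \<in> U \<longrightarrow> x \<notin> F \<longrightarrow>
        expo b x \<noteq> 0 \<and> b - var_monom x \<in> U"
  shows "\<exists>w. (\<forall>G. card G \<noteq> Suc p \<longrightarrow> w G = 0) \<and> (\<forall>G. supp (w G) \<subseteq> U) \<and>
      (\<forall>G. homogeneous (d - 1) (w G)) \<and> kbd w = c"
proof -
  have "\<exists>\<xi>. \<forall>a. int (monom_degree a) = d + int p \<longrightarrow>
      (\<forall>F b. card F = p \<longrightarrow> a = b + set_monom F \<longrightarrow> b \<in> U \<longrightarrow> \<xi> a \<notin> F \<longrightarrow>
        expo b (\<xi> a) \<noteq> 0 \<and> b - var_monom (\<xi> a) \<in> U)"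
    using cone by (intro choice) blast
  then obtain \<xi> where \<xi>: "int (monom_degree a) = d + int p \<Longrightarrow> card F = p \<Longrightarrow> a = b + set_monom F \<Longrightarrow>
      b \<in> U \<Longrightarrow> \<xi> a \<notin> F \<Longrightarrow> expo b (\<xi> a) \<noteq> 0 \<and> b - var_monom (\<xi> a) \<in> U" for a F b
    by metis
  have cF: "card F = p" "b \<in> U" "int (monom_degree (b + set_monom F)) = d + int p"
    if "b \<in> supp (c F)" for b F
  proof -
    show "card F = p"
      using chain[of F] that by fastforce
    then show "int (monom_degree (b + set_monom F)) = d + int p"
      using hom[of F] that by (simp add: homogeneous_def monom_degree_add monom_degree_set_monom)
    show "b \<in> U"
      using that supp by auto
  qed
  obtain w where w: "\<And>G b. coef (w G) b = (let x = \<xi> (b + set_monom G) in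
       if x \<in> G then ksign x (G - {x}) * coef (c (G - {x})) (b + var_monom x) else 0)"
    and kbd_w: "kbd w = c"
    using kbd_contraction[OF cycle, of \<xi>] \<xi> cF by metis
  have wG: "\<exists>x\<in>G. \<xi> (b + set_monom G) = x \<and> b + var_monom x \<in> supp (c (G - {x}))"
    if "coef (w G) b \<noteq> 0" for G b
    using that by (auto simp: w Let_def in_keys_iff split: if_splits)
  have "w G = 0" if "card G \<noteq> Suc p" for G
  proof (rule poly_mapping_eqI, rule ccontr)
    fix b assume "coef (w G) b \<noteq> coef 0 b"
    with wG[of G b] obtain x where "x \<in> G" "b + var_monom x \<in> supp (c (G - {x}))"
      by auto
    with cF(1)[of "b + var_monom x" "G - {x}"] that show False
      by (metis card_Suc_Diff1 finite_code)
  qed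
  moreover have "b \<in> U" if "b \<in> supp (w G)" for b G
  proof -
    from that wG[of G b] obtain x where x: "x \<in> G" "\<xi> (b + set_monom G) = x"
      "b + var_monom x \<in> supp (c (G - {x}))"
      by (auto simp: in_keys_iff)
    have a: "b + set_monom G = (b + var_monom x) + set_monom (G - {x})"
      using set_monom_insert[of x "G - {x}"] x(1) by (simp add: insert_absorb add.assoc)
    have "(b + var_monom x) - var_monom x \<in> U"
      using \<xi>[OF _ cF(1)[OF x(3)] a cF(2)[OF x(3)]] cF(3)[OF x(3)] x(2) by (simp add: a)
    then show "b \<in> U"
      by simp
  qed
  moreover have "homogeneous (d - 1) (w G)" for G
    unfolding homogeneous_def
  proof
    fix b assume "b \<in> supp (w G)"
    with wG[of G b] obtain x where "b + var_monom x \<in> supp (c (G - {x}))"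
      by (auto simp: in_keys_iff)
    then show "int (monom_degree b) = d - 1"
      using hom[of "G - {x}"] by (auto simp: homogeneous_def monom_degree_add)
  qed
  ultimately show ?thesis
    using kbd_w by blast
qed

text \<open>Every variable dividing the multidegree is a cone point, so homology can only sit in
  multidegree 0. There it is the residue field in homological degree 0, which \<open>aug\<close>
  excludes.\<close>

lemma koszul_exact_ring:
  fixes c :: "'v::finite set \<Rightarrow> ('v, 'k::field) mpoly"
  assumes cycle: "\<And>G. kbd c G = 0"
    and chain: "\<And>G. card G \<noteq> p \<Longrightarrow> c G = 0"
    and hom: "\<And>G. homogeneous d (c G)"
    and aug: "p = 0 \<Longrightarrow> coef (c {}) 0 = 0"
  shows "\<exists>w. (\<forall>G. card G \<noteq> Suc p \<longrightarrow> w G = 0) \<and> (\<forall>G. homogeneous (d - 1) (w G)) \<and> kbd w = c"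
proof (cases "p = 0 \<and> d = 0")
  case True
  have "c G = 0" for G
  proof (cases "G = {}")
    case G: True
    show ?thesis
      by (rule poly_mapping_eqI)
        (use aug hom[of "{}"] True G in \<open>metis homogeneousD lookup_zero monom_degree_eq_0_iff of_nat_eq_0_iff\<close>)
  qed (use True chain in simp)
  then show ?thesis
    by (intro exI[of _ "\<lambda>_. 0"]) (auto simp: fun_eq_iff)
next
  case False
  have "\<exists>w. (\<forall>G. card G \<noteq> Suc p \<longrightarrow> w G = 0) \<and> (\<forall>G. supp (w G) \<subseteq> UNIV) \<and>
      (\<forall>G. homogeneous (d - 1) (w G)) \<and> kbd w = c"
  proof (rule koszul_exact_monomial[OF cycle chain _ hom])
    fix a :: "'v monom"
    assume a: "int (monom_degree a) = d + int p"
    show "\<exists>x. \<forall>F b. card F = p \<longrightarrow> a = b + set_monom F \<longrightarrow> b \<in> UNIV \<longrightarrow> x \<notin> F \<longrightarrow>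
        expo b x \<noteq> 0 \<and> b - var_monom x \<in> UNIV"
    proof (cases "a = 0")
      case True
      have "F = {}" if "0 = b + set_monom F" for F and b :: "'v monom"
        using that by (metis add_is_0 card_0_eq finite_code monom_degree_0 monom_degree_add monom_degree_set_monom)
      moreover have "p \<noteq> 0"
        using True a False by auto
      ultimately show ?thesis
        unfolding True by (metis card.empty)
    next
      case False
      then obtain x where x: "expo a x \<noteq> 0"
        by (metis lookup_zero poly_mapping_eqI)
      then show ?thesis
        by (intro exI[of _ x]) (auto simp: lookup_add expo_set_monom)
    qed
  qed auto
  then show ?thesis
    by blast
qed

section \<open>Vectors, graded matrices and Koszul homology\<close>

text \<open>Vectors of length \<open>r\<close> as functions vanishing from index \<open>r\<close>
  on, so that pointwise operations need no carrier conditions.\<close>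

definition fvec :: "nat \<Rightarrow> (nat \<Rightarrow> 'r::zero) set" where
  "fvec r = {f. \<forall>i\<ge>r. f i = 0}"

definition mat_app :: "nat \<Rightarrow> (nat \<Rightarrow> nat \<Rightarrow> 'r::comm_ring_1) \<Rightarrow> (nat \<Rightarrow> 'r) \<Rightarrow> nat \<Rightarrow> 'r" where
  "mat_app q A f i = (\<Sum>b<q. A i b * f b)"

text \<open>Outside the ranges of the lists the shifts \<open>s ! i\<close> and \<open>t ! b\<close>
  are unspecified, but the entries there are 0 and thus homogeneous of every degree.\<close>

definition graded_mat ::
  "nat list \<Rightarrow> nat list \<Rightarrow> (nat \<Rightarrow> nat \<Rightarrow> ('v::finite, 'k::field) mpoly) \<Rightarrow> bool" where
  "graded_mat s t A \<longleftrightarrow>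
     (\<forall>i b. homogeneous (int (t ! b) - int (s ! i)) (A i b)) \<and>
     (\<forall>i b. length s \<le> i \<or> length t \<le> b \<longrightarrow> A i b = 0)"

text \<open>The degree \<open>j\<close> part of the \<open>p\<close>-th Koszul module of
  \<open>Z\<close>: \<open>C i G\<close> is the \<open>i\<close>-th coordinate of the coefficient on
  \<open>G\<close>, and the \<open>p\<close> exterior factors account for \<open>p\<close> of the
  degree.\<close>

definition koszul_chain :: "nat list \<Rightarrow> (nat \<Rightarrow> ('v::finite, 'k::field) mpoly) set \<Rightarrow> nat \<Rightarrow> int \<Rightarrow>
    (nat \<Rightarrow> 'v set \<Rightarrow> ('v, 'k) mpoly) \<Rightarrow> bool" where
  "koszul_chain s Z p j C \<longleftrightarrow>
     (\<forall>G. (\<lambda>i. C i G) \<in> Z) \<and> (\<forall>i G. card G \<noteq> p \<longrightarrow> C i G = 0) \<and>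
     (\<forall>i G. homogeneous (j - int (s ! i) - int p) (C i G))"

text \<open>For a graded submodule \<open>Z\<close> of \<open>S(-s\<^sub>1) \<oplus> \<cdots> \<oplus> S(-s\<^sub>r)\<close> this is \<open>Tor\<^sub>p(Z, \<k>)\<^sub>j = 0\<close>.\<close>

definition koszul_exact ::
  "nat list \<Rightarrow> (nat \<Rightarrow> ('v::finite, 'k::field) mpoly) set \<Rightarrow> nat \<Rightarrow> int \<Rightarrow> bool" where
  "koszul_exact s Z p j \<longleftrightarrow>
     (\<forall>C. koszul_chain s Z p j C \<longrightarrow> (\<forall>i G. kbd (C i) G = 0) \<longrightarrow>
        (\<exists>W. koszul_chain s Z (Suc p) j W \<and> (\<forall>i. kbd (W i) = C i)))"

section \<open>Graded maps between free modules\<close>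

lemma mat_app_0: "mat_app q A (\<lambda>_. 0) i = 0"
  by (simp add: mat_app_def)

lemma mat_app_add: "mat_app q A (\<lambda>b. f b + g b) i = mat_app q A f i + mat_app q A g i"
  by (simp add: mat_app_def algebra_simps sum.distrib)

lemma mat_app_diff: "mat_app q A (\<lambda>b. f b - g b) i = mat_app q A f i - mat_app q A g i"
  by (simp add: mat_app_def algebra_simps sum_subtractf)

lemma mat_app_scale: "mat_app q A (\<lambda>b. r * f b) i = r * mat_app q A f i"
  by (simp add: mat_app_def sum_distrib_left mult.left_commute)

lemma mat_app_sum: "mat_app q A (\<lambda>b. \<Sum>x\<in>I. f x b) i = (\<Sum>x\<in>I. mat_app q A (f x) i)"
  unfolding mat_app_def by (subst sum.swap) (simp add: sum_distrib_left)

lemma mat_app_unit: "b < q \<Longrightarrow> mat_app q A (\<lambda>c. if c = b then 1 else 0) i = A i b"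
  by (simp add: mat_app_def if_distrib sum.delta cong: if_cong)

lemma kbd_mat_app: "kbd (\<lambda>G. mat_app q A (\<lambda>b. C b G) i) G = mat_app q A (\<lambda>b. kbd (C b) G) i"
  unfolding mat_app_def by (rule kbd_linear_combination)

lemma hcomp_mat_app:
  assumes "graded_mat s t A"
  shows "hcomp (j - int (s ! i)) (mat_app q A f i) = mat_app q A (\<lambda>b. hcomp (j - int (t ! b)) (f b)) i"
proof -
  have "hcomp (j - int (s ! i)) (A i b * f b) = A i b * hcomp (j - int (t ! b)) (f b)" for b
  proof -
    have "homogeneous (int (t ! b) - int (s ! i)) (A i b)"
      using assms by (simp add: graded_mat_def)
    from hcomp_mult_left[OF this, of "j - int (s ! i)" "f b"] show ?thesis
      by simp
  qed
  then show ?thesis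
    by (simp add: mat_app_def hcomp_sum)
qed

lemma homogeneous_mat_app:
  assumes "graded_mat s t A" "\<And>b. homogeneous (j - int (t ! b)) (f b)"
  shows "homogeneous (j - int (s ! i)) (mat_app q A f i)"
  unfolding mat_app_def
proof (rule homogeneous_sum)
  fix b
  have "homogeneous (int (t ! b) - int (s ! i)) (A i b)"
    using assms by (simp add: graded_mat_def)
  from homogeneous_mult[OF this assms(2)[of b]]
  show "homogeneous (j - int (s ! i)) (A i b * f b)"
    by simp
qed

lemma homogeneous_kbd:
  assumes "\<And>G. homogeneous (d - 1) (c G)"
  shows "homogeneous d (kbd c G)"
  unfolding kbd_def
proof (intro homogeneous_sum homogeneous_ksign_times)
  fix x
  show "homogeneous d (var x * c (insert x G))"
    using homogeneous_mult[OF homogeneous_var assms] by simp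
qed

text \<open>The long exact sequence of \<open>0 \<rightarrow> ker A \<rightarrow> F \<rightarrow> im A \<rightarrow> 0\<close>, where \<open>F\<close> is free.\<close>

lemma koszul_exact_kernel:
  fixes A :: "nat \<Rightarrow> nat \<Rightarrow> ('v::finite, 'k::field) mpoly"
  assumes A: "graded_mat s t A"
    and ex: "koszul_exact s (mat_app (length t) A ` fvec (length t)) (Suc p) j"
    and Z: "Z = {f \<in> fvec (length t). mat_app (length t) A f = (\<lambda>_. 0)}"
    and aug: "\<And>f i. p = 0 \<Longrightarrow> f \<in> Z \<Longrightarrow> coef (f i) 0 = 0"
  shows "koszul_exact t Z p j"
  unfolding koszul_exact_def
proof (intro allI impI)
  define q where "q = length t"
  define M where "M = mat_app q A ` fvec q"
  fix C :: "nat \<Rightarrow> 'v set \<Rightarrow> ('v, 'k) mpoly"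
  assume C: "koszul_chain t Z p j C" and "\<forall>i G. kbd (C i) G = 0"
  then have cycle: "kbd (C i) G = 0" for i G
    by simp
  from C have CZ: "(\<lambda>i. C i G) \<in> Z" and Ccard: "card G \<noteq> p \<Longrightarrow> C i G = 0"
    and Chom: "homogeneous (j - int (t ! i) - int p) (C i G)" for i G
    by (auto simp: koszul_chain_def)
  have C0: "C i G = 0" if "i \<ge> q" for i G
    using CZ[of G] that by (auto simp: Z fvec_def q_def)
  have "\<exists>w. (\<forall>G. card G \<noteq> Suc p \<longrightarrow> w G = 0) \<and>
      (\<forall>G. homogeneous (j - int (t ! i) - int p - 1) (w G)) \<and> kbd w = C i" for i
    by (rule koszul_exact_ring[OF cycle Ccard Chom]) (use aug CZ in auto)
  then obtain w where wcard: "card G \<noteq> Suc p \<Longrightarrow> w i G = 0"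
    and whom: "homogeneous (j - int (t ! i) - int p - 1) (w i G)"
    and kbd_w: "kbd (w i) = C i" for i G
    by metis
  \<comment> \<open>The cycle is bounded in the free module one coordinate at a time. Beyond
    \<open>q\<close> the coordinates of \<open>C\<close> are 0, so resetting those of
    \<open>w\<close> keeps \<open>kbd (W i) = C i\<close>.\<close>
  define W where "W i = (if i < q then w i else (\<lambda>_. 0))" for i
  have W: "(\<lambda>b. W b G) \<in> fvec q" "card G \<noteq> Suc p \<Longrightarrow> W i G = 0"
    "homogeneous (j - int (t ! i) - int (Suc p)) (W i G)" "kbd (W i) = C i" for i G
    using wcard whom[of i G] kbd_w C0 by (auto simp: W_def fvec_def algebra_simps fun_eq_iff)
  \<comment> \<open>This is a cycle in the image of \<open>A\<close>, because \<open>A\<close> kills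
    \<open>C\<close>; exactness there bounds it by a chain \<open>V\<close>.\<close>
  define D where "D i G = mat_app q A (\<lambda>b. W b G) i" for i G
  have "koszul_chain s M (Suc p) j D"
    unfolding koszul_chain_def
  proof (intro conjI allI impI)
    fix i and G :: "'v set"
    show "(\<lambda>i. D i G) \<in> M"
      using W(1)[of G] by (auto simp: M_def D_def)
    show "card G \<noteq> Suc p \<Longrightarrow> D i G = 0"
      by (simp add: D_def W(2) mat_app_0)
    have "homogeneous (j - int (Suc p) - int (s ! i)) (D i G)"
      unfolding D_def
    proof (rule homogeneous_mat_app[OF A])
      fix b show "homogeneous (j - int (Suc p) - int (t ! b)) (W b G)"
        using W(3)[of b G] by (simp add: algebra_simps)
    qed
    then show "homogeneous (j - int (s ! i) - int (Suc p)) (D i G)"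
      by (simp add: algebra_simps)
  qed
  moreover have "kbd (D i) G = 0" for i G
  proof -
    have "mat_app q A (\<lambda>b. C b G) = (\<lambda>_. 0)"
      using CZ[of G] by (simp add: Z q_def)
    then show ?thesis
      unfolding D_def kbd_mat_app W(4) by (simp add: fun_eq_iff)
  qed
  ultimately obtain V where V: "koszul_chain s M (Suc (Suc p)) j V" and kbd_V: "\<And>i. kbd (V i) = D i"
    using ex unfolding koszul_exact_def M_def q_def by blast
  have "\<exists>v. v \<in> fvec q \<and> (\<lambda>i. V i G) = mat_app q A v" for G
    using V by (force simp: koszul_chain_def M_def)
  then obtain v where v: "v G \<in> fvec q" "(\<lambda>i. V i G) = mat_app q A (v G)" for G
    by metis
  \<comment> \<open>Arbitrary preimages of \<open>V\<close> need not be homogeneous or concentrated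
    in one exterior degree; the fitting component still maps to \<open>V\<close>.\<close>
  define V' where "V' b G = (if card G = Suc (Suc p) then
      hcomp (j - int (Suc (Suc p)) - int (t ! b)) (v G b) else 0)" for b G
  have V'V: "mat_app q A (\<lambda>b. V' b G) i = V i G" for i G
  proof (cases "card G = Suc (Suc p)")
    case True
    have "homogeneous (j - int (Suc (Suc p)) - int (s ! i)) (V i G)"
      using V by (simp add: koszul_chain_def algebra_simps)
    then have "V i G = hcomp (j - int (Suc (Suc p)) - int (s ! i)) (V i G)"
      by (simp add: hcomp_homogeneous)
    also have "V i G = mat_app q A (v G) i"
      using v(2)[of G] by (simp add: fun_eq_iff)
    also have "hcomp (j - int (Suc (Suc p)) - int (s ! i)) \<dots> = mat_app q A (\<lambda>b. V' b G) i"
      unfolding hcomp_mat_app[OF A] using True by (simp add: V'_def)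
    finally show ?thesis
      using v(2)[of G] by (simp add: fun_eq_iff)
  next
    case False
    then show ?thesis
      using V by (simp add: V'_def koszul_chain_def mat_app_0)
  qed
  \<comment> \<open>Subtracting a boundary does not change \<open>kbd (W i)\<close>, and it moves
    \<open>W\<close> into the kernel, since \<open>A\<close> sends the difference to
    \<open>D - kbd V = 0\<close>.\<close>
  define W' where "W' b G = W b G - kbd (V' b) G" for b G
  have "koszul_chain t Z (Suc p) j W'"
    unfolding koszul_chain_def
  proof (intro conjI allI impI)
    fix b and G :: "'v set"
    have "V' b G = 0" if "b \<ge> q" for b G
      using v(1)[of G] that by (simp add: V'_def fvec_def)
    then have "V' b = (\<lambda>_. 0)" if "b \<ge> q" for b
      using that by (simp add: fun_eq_iff)
    then have "(\<lambda>b. W' b G) \<in> fvec q"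
      using W(1)[of G] by (simp add: W'_def fvec_def)
    moreover have "mat_app q A (\<lambda>b. W' b G) i = 0" for i
    proof -
      have "mat_app q A (\<lambda>b. W' b G) i = D i G - kbd (\<lambda>G. mat_app q A (\<lambda>b. V' b G) i) G"
        by (simp only: W'_def mat_app_diff D_def kbd_mat_app)
      also have "\<dots> = D i G - kbd (V i) G"
        by (simp only: V'V)
      finally show ?thesis
        by (simp add: kbd_V)
    qed
    ultimately show "(\<lambda>b. W' b G) \<in> Z"
      by (auto simp: Z q_def)
    show "W' b G = 0" if "card G \<noteq> Suc p"
    proof -
      have "V' b (insert x G) = 0" if "x \<in> - G" for x
        using that \<open>card G \<noteq> Suc p\<close> by (simp add: V'_def)
      then have "kbd (V' b) G = 0"
        unfolding kbd_def by (intro sum.neutral) auto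
      then show ?thesis
        using W(2)[OF that] by (simp add: W'_def)
    qed
    have "homogeneous (j - int (t ! b) - int (Suc p)) (kbd (V' b) G)"
    proof (rule homogeneous_kbd)
      fix G
      have "j - int (t ! b) - int (Suc p) - 1 = j - int (Suc (Suc p)) - int (t ! b)"
        by simp
      then show "homogeneous (j - int (t ! b) - int (Suc p) - 1) (V' b G)"
        by (auto simp only: V'_def intro: homogeneous_hcomp homogeneous_0 split: if_split)
    qed
    then show "homogeneous (j - int (t ! b) - int (Suc p)) (W' b G)"
      unfolding W'_def by (intro homogeneous_diff W(3))
  qed
  moreover have "kbd (W' i) = C i" for i
  proof
    fix G
    have "kbd (W' i) G = kbd (W i) G - kbd (kbd (V' i)) G"
      unfolding W'_def by (rule kbd_diff)
    then show "kbd (W' i) G = C i G"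
      by (simp add: kbd_kbd W(4))
  qed
  ultimately show "\<exists>W. koszul_chain t Z (Suc p) j W \<and> (\<forall>i. kbd (W i) = C i)"
    by blast
qed

text \<open>A column of \<open>A\<close> that lies in \<open>\<mm> im A\<close> yields an element of the kernel with a unit entry.\<close>

lemma not_koszul_exact_image:
  fixes A :: "nat \<Rightarrow> nat \<Rightarrow> ('v::finite, 'k::field) mpoly"
  assumes A: "graded_mat s t A" and b: "b < length t"
    and ker: "\<And>f. f \<in> fvec (length t) \<Longrightarrow> mat_app (length t) A f = (\<lambda>_. 0) \<Longrightarrow> coef (f b) 0 = 0"
  shows "\<not> koszul_exact s (mat_app (length t) A ` fvec (length t)) 0 (int (t ! b))"
proof
  define q where "q = length t"
  define M where "M = mat_app q A ` fvec q"
  define e where "e = (\<lambda>c. if c = b then 1 else (0 :: ('v, 'k) mpoly))"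
  define C where "C i G = (if G = {} then A i b else 0)" for i and G :: "'v set"
  have e: "e \<in> fvec q" "mat_app q A e = (\<lambda>i. A i b)"
    using b by (auto simp: e_def fvec_def q_def mat_app_unit fun_eq_iff)
  have zero: "(\<lambda>_. 0) \<in> M"
    unfolding M_def by (rule image_eqI[of _ _ "\<lambda>_. 0"]) (auto simp: mat_app_0 fun_eq_iff fvec_def)
  assume "koszul_exact s (mat_app (length t) A ` fvec (length t)) 0 (int (t ! b))"
  moreover have "koszul_chain s M 0 (int (t ! b)) C"
    unfolding koszul_chain_def
  proof (intro conjI allI impI)
    fix i and G :: "'v set"
    show "(\<lambda>i. C i G) \<in> M"
      using zero e by (cases "G = {}") (auto simp: C_def M_def intro!: image_eqI[of _ _ e])
    show "homogeneous (int (t ! b) - int (s ! i) - int 0) (C i G)"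
      using A by (auto simp: C_def graded_mat_def)
  qed (auto simp: C_def)
  moreover have "kbd (C i) G = 0" for i G
    by (simp add: kbd_def C_def)
  ultimately obtain W where W: "koszul_chain s M (Suc 0) (int (t ! b)) W" "\<And>i. kbd (W i) = C i"
    unfolding koszul_exact_def M_def q_def by blast
  have "\<exists>u. u \<in> fvec q \<and> (\<lambda>i. W i {x}) = mat_app q A u" for x
    using W(1) by (force simp: koszul_chain_def M_def)
  then obtain u where u: "u x \<in> fvec q" "(\<lambda>i. W i {x}) = mat_app q A (u x)" for x
    by metis
  \<comment> \<open>The constant term of \<open>f b\<close> is 1, as everything subtracted is a
    multiple of a variable.\<close>
  define f where "f c = e c - (\<Sum>x\<in>UNIV. var x * u x c)" for c
  have "A i b = (\<Sum>x\<in>UNIV. var x * W i {x})" for i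
  proof -
    have "A i b = kbd (W i) {}"
      by (simp add: W(2) C_def)
    then show ?thesis
      by (simp add: kbd_def ksign_def)
  qed
  also have "(\<Sum>x\<in>UNIV. var x * W i {x}) = mat_app q A (\<lambda>c. \<Sum>x\<in>UNIV. var x * u x c) i" for i
    using u(2) by (simp add: mat_app_sum mat_app_scale fun_eq_iff)
  finally have *: "A i b = mat_app q A (\<lambda>c. \<Sum>x\<in>UNIV. var x * u x c) i" for i .
  have "f = (\<lambda>c. e c - (\<Sum>x\<in>UNIV. var x * u x c))"
    by (simp add: f_def fun_eq_iff)
  then have "mat_app q A f i = 0" for i
    using *[of i] e(2) by (simp add: mat_app_diff)
  then have "mat_app q A f = (\<lambda>_. 0)"
    by (simp add: fun_eq_iff)
  moreover have "f \<in> fvec q"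
    using e(1) u(1) by (simp add: f_def fvec_def)
  ultimately have "coef (f b) 0 = 0"
    using ker by (simp add: q_def)
  then show False
    by (simp add: f_def e_def lookup_minus lookup_sum coef_var_times)
qed

lemma sum_fun_apply: "(\<Sum>x\<in>I. f x) i = (\<Sum>x\<in>I. f x i)"
  by (induction I rule: infinite_finite_induct) auto

section \<open>Minimal graded free resolutions\<close>

text \<open>An ideal as a submodule of the free module of rank 1, on a par with the syzygy
  modules.\<close>

definition ideal_vecs :: "'r::zero set \<Rightarrow> (nat \<Rightarrow> 'r) set" where
  "ideal_vecs I = {f \<in> fvec 1. f 0 \<in> I}"

text \<open>The module \<open>F\<^sub>i\<close> of the resolution has the shifts \<open>t (i + 1)\<close>, and \<open>t 0 = [0]\<close> stands for \<open>S\<close>.\<close>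

definition minimal_resolution :: "('v::finite, 'k::field) mpoly set \<Rightarrow> (nat \<Rightarrow> nat list) \<Rightarrow>
    (nat \<Rightarrow> nat \<Rightarrow> nat \<Rightarrow> ('v, 'k) mpoly) \<Rightarrow> bool" where
  "minimal_resolution I t B \<longleftrightarrow> t 0 = [0] \<and>
     (\<forall>i. graded_mat (t i) (t (Suc i)) (B i)) \<and>
     mat_app (length (t 1)) (B 0) ` fvec (length (t 1)) = ideal_vecs I \<and>
     (\<forall>i. {f \<in> fvec (length (t (Suc i))). mat_app (length (t (Suc i))) (B i) f = (\<lambda>_. 0)} =
        mat_app (length (t (Suc (Suc i)))) (B (Suc i)) ` fvec (length (t (Suc (Suc i))))) \<and>
     (\<forall>i a b. coef (B (Suc i) a b) 0 = 0)"

lemma coef_mult_0: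
  fixes p q :: "('v, 'k::field) mpoly"
  shows "coef (p * q) 0 = coef p 0 * coef q 0"
proof -
  have "p * q \<in> maximal_homogeneous_ideal" if "p \<in> maximal_homogeneous_ideal"
    for p q :: "('v, 'k::field) mpoly"
    using that by (simp add: maximal_homogeneous_ideal_def ideal_of_mult mult.commute[of p])
  then have m: "coef (p * q) 0 = 0" if "coef p 0 = 0" for p q :: "('v, 'k::field) mpoly"
    using that by (simp add: maximal_homogeneous_ideal_iff)
  define c :: "('v, 'k) mpoly" where "c = Poly_Mapping.single 0 (coef p 0)"
  have "coef ((p - c) * q) 0 = 0"
    by (rule m) (simp add: c_def lookup_minus)
  moreover have "coef (c * q) 0 = coef p 0 * coef q 0"
    using coef_single_times[of 0 "coef p 0" q 0] by (simp add: c_def)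
  ultimately show ?thesis
    by (simp add: left_diff_distrib lookup_minus)
qed

text \<open>Dimension shifting: \<open>koszul_exact_kernel\<close> trades one homological degree for
  one syzygy, so exactness at \<open>i\<close> for the ideal becomes exactness at 0 for the syzygy
  module \<open>M i\<close>. That would put the image of a basis element of degree \<open>j\<close>
  into the maximal ideal times \<open>M i\<close>, against minimality.\<close>

lemma minimal_resolution_not_koszul_exact:
  assumes res: "minimal_resolution I t B" and j: "j \<in> set (t (Suc i))"
  shows "\<not> koszul_exact [0] (ideal_vecs I) i (int j)"
proof
  define M where "M i = mat_app (length (t (Suc i))) (B i) ` fvec (length (t (Suc i)))" for i
  have gr: "graded_mat (t i) (t (Suc i)) (B i)" for i
    using res by (simp add: minimal_resolution_def)
  have ker: "{f \<in> fvec (length (t (Suc i))). mat_app (length (t (Suc i))) (B i) f = (\<lambda>_. 0)} = M (Suc i)" for i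
    using res by (simp add: minimal_resolution_def M_def)
  have aug: "coef (f a) 0 = 0" if "f \<in> M (Suc i)" for f i a
  proof -
    have "coef (B (Suc i) a b) 0 = 0" for b
      using res by (simp add: minimal_resolution_def)
    then show ?thesis
      using that by (auto simp: M_def mat_app_def lookup_sum coef_mult_0)
  qed
  assume "koszul_exact [0] (ideal_vecs I) i (int j)"
  then have *: "koszul_exact (t 0) (M 0) (i + 0) (int j)"
    using res by (simp add: minimal_resolution_def M_def)
  have "koszul_exact (t n) (M n) p (int j)" if "koszul_exact (t 0) (M 0) (n + p) (int j)" for n p
    using that
  proof (induction n arbitrary: p)
    case (Suc n)
    then have ex: "koszul_exact (t n) (M n) (Suc p) (int j)"
      by simp
    show ?case
    proof (rule koszul_exact_kernel[OF gr ex[unfolded M_def]])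
      show "M (Suc n) = {f \<in> fvec (length (t (Suc n))). mat_app (length (t (Suc n))) (B n) f = (\<lambda>_. 0)}"
        by (rule ker[symmetric])
    qed (rule aug)
  qed simp
  from this[OF *] have "koszul_exact (t i) (M i) 0 (int j)" .
  moreover obtain b where b: "b < length (t (Suc i))" "t (Suc i) ! b = j"
    using j by (metis in_set_conv_nth)
  have "\<not> koszul_exact (t i) (M i) 0 (int (t (Suc i) ! b))"
    unfolding M_def
    by (rule not_koszul_exact_image[OF gr b(1)]) (use ker[of i] aug in blast)
  ultimately show False
    by (simp add: b)
qed

section \<open>Finite generation and existence of minimal resolutions\<close>

definition graded_submodule :: "nat list \<Rightarrow> (nat \<Rightarrow> ('v::finite, 'k::field) mpoly) set \<Rightarrow> bool" where
  "graded_submodule s Z \<longleftrightarrow> Z \<subseteq> fvec (length s) \<and> (\<lambda>_. 0) \<in> Z \<and>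
     (\<forall>f\<in>Z. \<forall>g\<in>Z. (\<lambda>i. f i + g i) \<in> Z) \<and> (\<forall>r. \<forall>f\<in>Z. (\<lambda>i. r * f i) \<in> Z) \<and>
     (\<forall>j. \<forall>f\<in>Z. (\<lambda>i. hcomp (j - int (s ! i)) (f i)) \<in> Z)"

definition homogeneous_vec :: "nat list \<Rightarrow> int \<Rightarrow> (nat \<Rightarrow> ('v::finite, 'k::field) mpoly) \<Rightarrow> bool" where
  "homogeneous_vec s j f \<longleftrightarrow> (\<forall>i. homogeneous (j - int (s ! i)) (f i))"

lemma module_fun: "Modules.module (\<lambda>(r :: 'r::comm_ring_1) f (i :: 'i). r * (f i :: 'r))"
  by unfold_locales (simp_all add: algebra_simps fun_eq_iff)

abbreviation fspan :: "('i \<Rightarrow> 'r::comm_ring_1) set \<Rightarrow> ('i \<Rightarrow> 'r) set" where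
  "fspan \<equiv> Modules.module.span (\<lambda>r f i. r * f i)"

lemmas fspan_base = Modules.module.span_base[OF module_fun]
  and fspan_finite = Modules.module.span_finite[OF module_fun]
  and fspan_scale = Modules.module.span_scale[OF module_fun]
  and fspan_sum = Modules.module.span_sum[OF module_fun]
  and fspan_zero = Modules.module.span_zero[OF module_fun]

lemma fspan_minimal:
  assumes "B \<subseteq> Z" "0 \<in> Z" "\<And>f g. f \<in> Z \<Longrightarrow> g \<in> Z \<Longrightarrow> f + g \<in> Z"
    "\<And>r f. f \<in> Z \<Longrightarrow> (\<lambda>i. r * f i) \<in> Z"
  shows "fspan B \<subseteq> Z"
  using assms by (intro Modules.module.span_minimal[OF module_fun] Modules.module.subspaceI[OF module_fun])

text \<open>Scalars act as constant polynomials; this gives access to linear independence and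
  dimension over the field.\<close>

lemma vector_space_fun:
  "vector_space (\<lambda>(c :: 'k::field) f (i :: nat). Poly_Mapping.single 0 c * (f i :: ('v, 'k) mpoly))"
  by unfold_locales (simp_all add: algebra_simps fun_eq_iff single_add mult_single flip: mult.assoc)

text \<open>Homogeneous vectors of degree \<open>j\<close> lie in a finite-dimensional space,
  spanned by monomials in single coordinates; a maximal independent subset of \<open>Z\<close> is
  therefore finite.\<close>

lemma finite_spanning_homogeneous:
  fixes Z :: "(nat \<Rightarrow> ('v::finite, 'k::field) mpoly) set"
  assumes "Z \<subseteq> fvec (length s)" "\<And>f. f \<in> Z \<Longrightarrow> homogeneous_vec s j f"
  shows "\<exists>B\<subseteq>Z. finite B \<and> Z \<subseteq> fspan B"
proof -
  interpret V: vector_space "\<lambda>(c :: 'k) f (i :: nat). Poly_Mapping.single 0 c * (f i :: ('v, 'k) mpoly)"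
    by (rule vector_space_fun)
  define e where "e i m = (\<lambda>i'. if i' = i then Poly_Mapping.single m 1 else (0 :: ('v, 'k) mpoly))"
    for i :: nat and m
  \<comment> \<open>Where \<open>j < s ! i\<close>, \<open>nat\<close> turns the degree into 0 and
    \<open>T\<close> gains a constant vector. This is harmless, since \<open>T\<close> only has to
    span.\<close>
  define T where "T = (\<Union>i<length s. e i ` {m. monom_degree m = nat (j - int (s ! i))})"
  have "finite T"
    by (simp add: T_def finite_monoms_of_degree)
  have "f \<in> V.span T" if "f \<in> Z" for f
  proof -
    have f: "f = (\<Sum>i<length s. \<Sum>m\<in>supp (f i). (\<lambda>i'. Poly_Mapping.single 0 (coef (f i) m) * e i m i'))"
    proof
      fix i'
      have "(\<Sum>m\<in>supp (f i). Poly_Mapping.single 0 (coef (f i) m) * e i m i') =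
          (if i = i' then f i' else 0)" for i
        by (simp add: e_def mult_single sum_single_keys)
      then have "(\<Sum>i<length s. \<Sum>m\<in>supp (f i). Poly_Mapping.single 0 (coef (f i) m) * e i m i') =
          (if i' < length s then f i' else 0)"
        by (simp add: sum.delta)
      also have "\<dots> = f i'"
        using assms(1) that by (auto simp: fvec_def)
      finally show "f i' = (\<Sum>i<length s. \<Sum>m\<in>supp (f i).
          (\<lambda>i'. Poly_Mapping.single 0 (coef (f i) m) * e i m i')) i'"
        by (simp add: sum_fun_apply)
    qed
    show ?thesis
    proof (subst f, intro V.span_sum V.span_scale V.span_base)
      fix i m assume "i \<in> {..<length s}" "m \<in> supp (f i)"
      then have "int (monom_degree m) = j - int (s ! i)" "i < length s"
        using assms(2)[OF that] by (auto simp: homogeneous_vec_def homogeneous_def)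
      then have "m \<in> {m. monom_degree m = nat (j - int (s ! i))}" "i \<in> {..<length s}"
        by (simp_all flip: \<open>int (monom_degree m) = _\<close>)
      then show "e i m \<in> T"
        unfolding T_def by blast
    qed
  qed
  moreover obtain B where B: "B \<subseteq> Z" "V.independent B" "Z \<subseteq> V.span B"
    using V.maximal_independent_subset by blast
  ultimately have "finite B"
    using V.independent_span_bound[OF \<open>finite T\<close> B(2)] by blast
  moreover have "V.span B \<subseteq> fspan B"
  proof (rule V.span_minimal)
    show "V.subspace (fspan B)"
      by (intro V.subspaceI fspan_zero fspan_scale Modules.module.span_add[OF module_fun])
  qed (auto intro: fspan_base)
  ultimately show ?thesis
    using B by blast
qed

text \<open>The graded Nakayama argument in terms of chains: \<open>f\<close> is a 0-cycle, and a
  1-chain bounding it writes it as a combination of elements of degree \<open>j - 1\<close> with the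
  variables as coefficients.\<close>

lemma koszul_exact_degree_0D:
  fixes Z :: "(nat \<Rightarrow> ('v::finite, 'k::field) mpoly) set"
  assumes "koszul_exact s Z 0 j" "f \<in> Z" "(\<lambda>_. 0) \<in> Z" "homogeneous_vec s j f"
  shows "\<exists>u. (\<forall>x. u x \<in> Z \<and> homogeneous_vec s (j - 1) (u x)) \<and> (\<forall>i. f i = (\<Sum>x\<in>UNIV. var x * u x i))"
proof -
  define C where "C i G = (if G = {} then f i else 0)" for i and G :: "'v set"
  have "koszul_chain s Z 0 j C"
    unfolding koszul_chain_def
  proof (intro conjI allI impI)
    fix G :: "'v set"
    show "(\<lambda>i. C i G) \<in> Z"
      using assms by (cases "G = {}") (auto simp: C_def)
  qed (use assms in \<open>auto simp: C_def homogeneous_vec_def\<close>)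
  moreover have "kbd (C i) G = 0" for i G
    by (simp add: kbd_def C_def)
  ultimately obtain W where W: "koszul_chain s Z (Suc 0) j W" "\<And>i. kbd (W i) = C i"
    using assms(1) unfolding koszul_exact_def by blast
  have "f i = (\<Sum>x\<in>UNIV. var x * W i {x})" for i
  proof -
    have "f i = kbd (W i) {}"
      by (simp add: W(2) C_def)
    then show ?thesis
      by (simp add: kbd_def ksign_def)
  qed
  moreover have "homogeneous_vec s (j - 1) (\<lambda>i. W i {x})" for x
    using W(1) by (simp add: koszul_chain_def homogeneous_vec_def algebra_simps)
  ultimately show ?thesis
    using W(1) by (intro exI[of _ "\<lambda>x i. W i {x}"]) (auto simp: koszul_chain_def)
qed

lemma homogeneous_decomposition:
  fixes f :: "nat \<Rightarrow> ('v::finite, 'k::field) mpoly"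
  assumes "f \<in> fvec (length s)"
  shows "\<exists>D. finite D \<and> f = (\<Sum>d\<in>D. (\<lambda>i. hcomp (int d - int (s ! i)) (f i)))"
proof -
  define D where "D = (\<Union>i<length s. (\<lambda>m. monom_degree m + s ! i) ` supp (f i))"
  have "finite D"
    by (simp add: D_def)
  have "f i = (\<Sum>d\<in>D. hcomp (int d - int (s ! i)) (f i))" for i
  proof (rule poly_mapping_eqI)
    fix m
    have "coef (\<Sum>d\<in>D. hcomp (int d - int (s ! i)) (f i)) m =
        (\<Sum>d\<in>D. if d = monom_degree m + s ! i then coef (f i) m else 0)"
      by (auto simp: lookup_sum coef_hcomp intro!: sum.cong)
    also have "\<dots> = (if monom_degree m + s ! i \<in> D then coef (f i) m else 0)"
      using \<open>finite D\<close> by simp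
    also have "\<dots> = coef (f i) m"
    proof (cases "coef (f i) m = 0")
      case False
      then have "i < length s"
        using assms by (cases "i < length s") (auto simp: fvec_def)
      moreover have "monom_degree m + s ! i \<in> (\<lambda>m. monom_degree m + s ! i) ` supp (f i)"
        using False by (intro imageI) (simp add: in_keys_iff)
      ultimately show ?thesis
        unfolding D_def by auto
    qed simp
    finally show "coef (f i) m = coef (\<Sum>d\<in>D. hcomp (int d - int (s ! i)) (f i)) m" ..
  qed
  then have "f = (\<Sum>d\<in>D. (\<lambda>i. hcomp (int d - int (s ! i)) (f i)))"
    by (simp add: fun_eq_iff sum_fun_apply)
  with \<open>finite D\<close> show ?thesis
    by blast
qed

text \<open>Above degree \<open>N\<close> every homogeneous element comes from one degree lower by
  multiplication with variables, so the pieces of degree at most \<open>N\<close> generate, and each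
  of them is finite-dimensional.\<close>

lemma finite_homogeneous_generators:
  fixes Z :: "(nat \<Rightarrow> ('v::finite, 'k::field) mpoly) set"
  assumes Z: "graded_submodule s Z" and ex: "\<And>j. j > int N \<Longrightarrow> koszul_exact s Z 0 j"
  shows "\<exists>B. finite B \<and> fspan B = Z \<and> (\<forall>v\<in>B. \<exists>d::nat. homogeneous_vec s (int d) v)"
proof -
  define H where "H d = {f \<in> Z. homogeneous_vec s (int d) f}" for d
  have "\<exists>B\<subseteq>H d. finite B \<and> H d \<subseteq> fspan B" for d
    using Z by (intro finite_spanning_homogeneous) (auto simp: H_def graded_submodule_def)
  then obtain b where b: "b d \<subseteq> H d" "finite (b d)" "H d \<subseteq> fspan (b d)" for d
    by metis
  define B where "B = (\<Union>d\<le>N. b d)"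
  have H: "H d \<subseteq> fspan B" for d
  proof (induction d rule: less_induct)
    case (less d)
    show ?case
    proof (cases "d \<le> N")
      case True
      then have "b d \<subseteq> B"
        by (auto simp: B_def)
      then show ?thesis
        using b(3)[of d] Modules.module.span_mono[OF module_fun] by blast
    next
      case False
      show ?thesis
      proof
        fix f assume f: "f \<in> H d"
        then obtain u where u: "\<And>x. u x \<in> Z" "\<And>x. homogeneous_vec s (int d - 1) (u x)"
          "\<And>i. f i = (\<Sum>x\<in>UNIV. var x * u x i)"
          using koszul_exact_degree_0D[OF ex[of "int d"], of f] False Z
          unfolding H_def graded_submodule_def by auto
        then have "u x \<in> H (d - 1)" for x
          using False by (auto simp: H_def of_nat_diff)
        then have "u x \<in> fspan B" for x
          using less.IH[of "d - 1"] False by auto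
        moreover have "f = (\<Sum>x\<in>UNIV. (\<lambda>i. var x * u x i))"
          using u(3) by (simp add: fun_eq_iff sum_fun_apply)
        ultimately show "f \<in> fspan B"
          by (auto intro!: fspan_sum fspan_scale)
      qed
    qed
  qed
  have "Z \<subseteq> fspan B"
  proof
    fix f assume f: "f \<in> Z"
    then obtain D where D: "f = (\<Sum>d\<in>D. (\<lambda>i. hcomp (int d - int (s ! i)) (f i)))"
      using homogeneous_decomposition[of f s] Z by (auto simp: graded_submodule_def)
    have "(\<lambda>i. hcomp (int d - int (s ! i)) (f i)) \<in> fspan B" for d
      using f Z H[of d] by (auto simp: H_def graded_submodule_def homogeneous_vec_def homogeneous_hcomp)
    then show "f \<in> fspan B"
      by (subst D) (rule fspan_sum)
  qed
  moreover have "fspan B \<subseteq> Z"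
    using b(1) Z
    by (intro fspan_minimal) (auto simp: B_def H_def graded_submodule_def plus_fun_def zero_fun_def)
  moreover have "finite B"
    using b(2) by (simp add: B_def)
  ultimately show ?thesis
    using b(1) by (intro exI[of _ B]) (force simp: B_def H_def)
qed

lemma fspan_list_eq_mat_app_image:
  fixes bs :: "(nat \<Rightarrow> 'r::comm_ring_1) list"
  assumes "distinct bs"
  shows "fspan (set bs) =
    mat_app (length bs) (\<lambda>i b. if b < length bs then (bs ! b) i else 0) ` fvec (length bs)"
    (is "_ = mat_app ?q ?A ` _")
proof
  have app: "mat_app ?q ?A f = (\<Sum>b<?q. (\<lambda>i. f b * (bs ! b) i))" for f
    by (auto simp: mat_app_def fun_eq_iff sum_fun_apply mult.commute intro!: sum.cong)
  show "mat_app ?q ?A ` fvec ?q \<subseteq> fspan (set bs)"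
    unfolding app by (intro image_subsetI fspan_sum fspan_scale fspan_base) simp
  show "fspan (set bs) \<subseteq> mat_app ?q ?A ` fvec ?q"
  proof
    fix g assume "g \<in> fspan (set bs)"
    then obtain u where g: "g = (\<Sum>v\<in>set bs. (\<lambda>i. u v * v i))"
      by (auto simp: fspan_finite)
    have "bij_betw ((!) bs) {..<?q} (set bs)"
      using assms by (rule bij_betw_nth) auto
    from sum.reindex_bij_betw[OF this, of "\<lambda>v i. u v * v i"]
    have "g = mat_app ?q ?A (\<lambda>b. if b < ?q then u (bs ! b) else 0)"
      by (simp add: g app)
    then show "g \<in> mat_app ?q ?A ` fvec ?q"
      by (intro image_eqI[of _ _ "\<lambda>b. if b < ?q then u (bs ! b) else 0"]) (auto simp: fvec_def)
  qed
qed

text \<open>The columns are a homogeneous generating set of least cardinality: a relation with a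
  unit entry would express one generator through the others.\<close>

lemma minimal_presentation:
  fixes Z :: "(nat \<Rightarrow> ('v::finite, 'k::field) mpoly) set"
  assumes Z: "graded_submodule s Z" and ex: "\<And>j. j > int N \<Longrightarrow> koszul_exact s Z 0 j"
  shows "\<exists>t A. graded_mat s t A \<and> mat_app (length t) A ` fvec (length t) = Z \<and>
    (\<forall>f\<in>fvec (length t). mat_app (length t) A f = (\<lambda>_. 0) \<longrightarrow> (\<forall>b. coef (f b) 0 = 0))"
proof -
  define P where "P B \<longleftrightarrow> finite B \<and> fspan B = Z \<and> (\<forall>v\<in>B. \<exists>d::nat. homogeneous_vec s (int d) v)" for B
  have "\<exists>B. P B"
    using finite_homogeneous_generators[OF Z ex] by (simp add: P_def)
  then obtain B where B: "P B" and least: "\<And>B'. P B' \<Longrightarrow> card B \<le> card B'"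
    using ex_has_least_nat[of P _ card] by blast
  obtain bs where bs: "set bs = B" "distinct bs"
    using B finite_distinct_list by (auto simp: P_def)
  obtain dg :: "_ \<Rightarrow> nat" where dg: "\<And>v. v \<in> B \<Longrightarrow> homogeneous_vec s (int (dg v)) v"
    using B unfolding P_def by metis
  define q where "q = length bs"
  define t where "t = map dg bs"
  define A where "A i b = (if b < q then (bs ! b) i else 0)" for i b
  have len: "length t = q"
    by (simp add: t_def q_def)
  have BZ: "B \<subseteq> Z"
    using B fspan_base by (auto simp: P_def)
  have inB: "bs ! b \<in> B" if "b < q" for b
    using that bs by (auto simp: q_def)
  have gr: "graded_mat s t A"
    unfolding graded_mat_def
  proof (intro conjI allI impI)
    fix i b
    show "homogeneous (int (t ! b) - int (s ! i)) (A i b)"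
      using dg[OF inB[of b]] by (auto simp: A_def t_def q_def homogeneous_vec_def)
    assume "length s \<le> i \<or> length t \<le> b"
    then show "A i b = 0"
      using inB[of b] BZ Z by (auto simp: A_def len graded_submodule_def fvec_def)
  qed
  have "mat_app q A ` fvec q = fspan B"
    using fspan_list_eq_mat_app_image[OF bs(2)] by (simp add: bs q_def A_def[abs_def])
  then have im: "mat_app q A ` fvec q = Z"
    using B by (simp add: P_def)
  have "coef (f b) 0 = 0" if f: "f \<in> fvec q" "mat_app q A f = (\<lambda>_. 0)" for f b
  proof (rule ccontr)
    assume nz: "coef (f b) 0 \<noteq> 0"
    then have b: "b < q"
      using f(1) by (cases "b < q") (auto simp: fvec_def)
    \<comment> \<open>A nonzero constant term does not make \<open>f b\<close> invertible. Passing
      to the component in the degree of generator \<open>b\<close> reduces that entry to the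
      constant \<open>\<kappa>\<close>, which is.\<close>
    define f' where "f' c = hcomp (int (t ! b) - int (t ! c)) (f c)" for c
    define \<kappa> where "\<kappa> = coef (f b) 0"
    have f'b: "f' b = Poly_Mapping.single 0 \<kappa>"
      by (rule poly_mapping_eqI) (auto simp: f'_def coef_hcomp \<kappa>_def lookup_single when_def)
    have "mat_app q A f' i = 0" for i
      unfolding f'_def using hcomp_mat_app[OF gr, of "int (t ! b)" i q f] f(2) by (simp add: len)
    then have "(\<Sum>c<q. f' c * (bs ! c) i) = 0" for i
      by (simp add: mat_app_def A_def mult.commute cong: if_cong)
    then have "f' b * (bs ! b) i + (\<Sum>c\<in>{..<q} - {b}. f' c * (bs ! c) i) = 0" for i
      using b by (subst sum.remove[symmetric]) auto
    then have "f' b * (bs ! b) i = - (\<Sum>c\<in>{..<q} - {b}. f' c * (bs ! c) i)" for i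
      by (simp add: eq_neg_iff_add_eq_0)
    then have "Poly_Mapping.single 0 (inverse \<kappa>) * (f' b * (bs ! b) i) =
        (\<Sum>c\<in>{..<q} - {b}. (- Poly_Mapping.single 0 (inverse \<kappa>) * f' c) * (bs ! c) i)" for i
      by (simp add: sum_distrib_left mult.assoc sum_negf)
    moreover have "Poly_Mapping.single 0 (inverse \<kappa>) * (f' b * (bs ! b) i) = (bs ! b) i" for i
      using nz by (simp add: f'b mult_single \<kappa>_def flip: mult.assoc)
    ultimately have "bs ! b = (\<Sum>c\<in>{..<q} - {b}. (\<lambda>i. (- Poly_Mapping.single 0 (inverse \<kappa>) * f' c) * (bs ! c) i))"
      by (simp add: fun_eq_iff sum_fun_apply)
    also have "\<dots> \<in> fspan (B - {bs ! b})"
    proof (intro fspan_sum fspan_scale fspan_base)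
      fix c assume "c \<in> {..<q} - {b}"
      then show "bs ! c \<in> B - {bs ! b}"
        using b bs by (auto simp: q_def nth_eq_iff_index_eq)
    qed
    finally have v: "bs ! b \<in> fspan (B - {bs ! b})" .
    have "B \<subseteq> fspan (B - {bs ! b})"
    proof
      fix w assume "w \<in> B"
      with v show "w \<in> fspan (B - {bs ! b})"
        by (cases "w = bs ! b") (auto intro: fspan_base)
    qed
    then have "fspan B \<subseteq> fspan (B - {bs ! b})"
      using Modules.module.span_mono[OF module_fun] Modules.module.span_span[OF module_fun] by blast
    moreover have "fspan (B - {bs ! b}) \<subseteq> fspan B"
      by (rule Modules.module.span_mono[OF module_fun]) blast
    ultimately have "P (B - {bs ! b})"
      using B by (auto simp: P_def)
    from least[OF this] show False
      using B inB[OF b] by (metis P_def card_Diff1_less not_le)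
  qed
  with gr im show ?thesis
    unfolding len[symmetric] by blast
qed

lemma graded_submodule_kernel:
  assumes "graded_mat s t A"
  shows "graded_submodule t {f \<in> fvec (length t). mat_app (length t) A f = (\<lambda>_. 0)}"
  unfolding graded_submodule_def
proof (intro conjI ballI allI)
  fix j f assume "f \<in> {f \<in> fvec (length t). mat_app (length t) A f = (\<lambda>_. 0)}"
  then show "(\<lambda>i. hcomp (j - int (t ! i)) (f i)) \<in> {f \<in> fvec (length t). mat_app (length t) A f = (\<lambda>_. 0)}"
    using hcomp_mat_app[OF assms, of j _ _ f, symmetric] by (auto simp: fvec_def fun_eq_iff)
qed (auto simp: fvec_def mat_app_0 mat_app_add mat_app_scale fun_eq_iff)

text \<open>Vanishing above a line of slope 1 is inherited by the kernel of a minimal presentation,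
  so presentations can be iterated. The state of the iteration is a shift list with a submodule of
  the corresponding free module.\<close>

lemma minimal_resolution_exists:
  fixes I :: "('v::finite, 'k::field) mpoly set"
  assumes I: "graded_submodule [0] (ideal_vecs I)"
    and ex: "\<And>p j. j > int N + int p \<Longrightarrow> koszul_exact [0] (ideal_vecs I) p j"
  shows "\<exists>t B. minimal_resolution I t B"
proof -
  define ker where "ker t A = {f \<in> fvec (length t). mat_app (length t) A f = (\<lambda>_. 0)}"
    for t :: "nat list" and A :: "nat \<Rightarrow> nat \<Rightarrow> ('v, 'k) mpoly"
  define admissible where "admissible = (\<lambda>(s, Z :: (nat \<Rightarrow> ('v, 'k) mpoly) set). graded_submodule s Z \<and>
      (\<exists>N. \<forall>p j. j > int N + int p \<longrightarrow> koszul_exact s Z p j))"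
  define R where "R = (\<lambda>(s, Z) (t, Z'). \<exists>A. graded_mat s t A \<and>
      mat_app (length t) A ` fvec (length t) = Z \<and> Z' = ker t A \<and> (\<forall>f\<in>Z'. \<forall>b. coef (f b) 0 = 0))"
  have "\<exists>X. \<forall>n. (admissible (X n) \<and> (n = 0 \<longrightarrow> X n = ([0], ideal_vecs I))) \<and> R (X n) (X (Suc n))"
  proof (rule dependent_nat_choice)
    show "\<exists>x. admissible x \<and> (0 = (0 :: nat) \<longrightarrow> x = ([0], ideal_vecs I))"
      using assms by (auto simp: admissible_def)
    fix x :: "nat list \<times> (nat \<Rightarrow> ('v, 'k) mpoly) set" and n :: nat
    obtain s Z where x: "x = (s, Z)"
      by fastforce
    assume "admissible x \<and> (n = 0 \<longrightarrow> x = ([0], ideal_vecs I))"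
    then obtain N where Z: "graded_submodule s Z" and N: "\<And>p j. j > int N + int p \<Longrightarrow> koszul_exact s Z p j"
      by (auto simp: admissible_def x)
    obtain t A where A: "graded_mat s t A" "mat_app (length t) A ` fvec (length t) = Z"
      and aug: "\<And>f b. f \<in> ker t A \<Longrightarrow> coef (f b) 0 = 0"
      using minimal_presentation[OF Z, of N] N[of 0] unfolding ker_def by auto
    \<comment> \<open>Exactness at \<open>Suc p\<close> is consumed to get exactness at
      \<open>p\<close>, so the bound grows by one with each syzygy; hence the bound in
      \<open>admissible\<close> is existential.\<close>
    have "koszul_exact t (ker t A) p j" if "j > int (Suc N) + int p" for p j
    proof (rule koszul_exact_kernel[OF A(1)])
      show "koszul_exact s (mat_app (length t) A ` fvec (length t)) (Suc p) j"
        unfolding A(2) using that by (intro N) simp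
    qed (auto simp: ker_def intro: aug[unfolded ker_def])
    then have "admissible (t, ker t A)"
      using graded_submodule_kernel[OF A(1)] unfolding admissible_def ker_def by blast
    moreover have "R x (t, ker t A)"
      unfolding R_def x using A aug by blast
    ultimately show "\<exists>y. (admissible y \<and> (Suc n = 0 \<longrightarrow> y = ([0], ideal_vecs I))) \<and> R x y"
      by blast
  qed
  then obtain X where X: "X 0 = ([0], ideal_vecs I)" "\<And>n. R (X n) (X (Suc n))"
    by metis
  define t where "t n = fst (X n)" for n
  define Z where "Z n = snd (X n)" for n
  have "\<exists>A. graded_mat (t n) (t (Suc n)) A \<and>
      mat_app (length (t (Suc n))) A ` fvec (length (t (Suc n))) = Z n \<and>
      Z (Suc n) = ker (t (Suc n)) A \<and> (\<forall>f\<in>Z (Suc n). \<forall>b. coef (f b) 0 = 0)" for n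
    using X(2)[of n] by (simp add: R_def t_def Z_def case_prod_unfold)
  then obtain B where B: "graded_mat (t n) (t (Suc n)) (B n)"
    "mat_app (length (t (Suc n))) (B n) ` fvec (length (t (Suc n))) = Z n"
    "Z (Suc n) = ker (t (Suc n)) (B n)" "\<And>f b. f \<in> Z (Suc n) \<Longrightarrow> coef (f b) 0 = 0" for n
    by metis
  \<comment> \<open>A column is the image of a unit vector, hence an element of the preceding
    kernel, all of whose entries lie in the maximal ideal.\<close>
  have "coef (B (Suc i) a b) 0 = 0" for i a b
  proof (cases "b < length (t (Suc (Suc i)))")
    case True
    let ?e = "\<lambda>c. if c = b then 1 else (0 :: ('v, 'k) mpoly)"
    have "mat_app (length (t (Suc (Suc i)))) (B (Suc i)) ?e \<in> Z (Suc i)"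
      using True unfolding B(2)[symmetric] by (intro imageI) (auto simp: fvec_def)
    from B(4)[OF this, of a] show ?thesis
      using True by (simp add: mat_app_unit)
  next
    case False
    then show ?thesis
      using B(1)[of "Suc i"] by (simp add: graded_mat_def)
  qed
  moreover have "t 0 = [0]" "Z 0 = ideal_vecs I"
    by (simp_all add: t_def Z_def X)
  ultimately have "minimal_resolution I t B"
    unfolding minimal_resolution_def using B(1,2) B(3)[unfolded ker_def, symmetric] by simp
  then show ?thesis
    by blast
qed

section \<open>Minimal covers of unmixed graphs\<close>

definition independent_set :: "'v set set \<Rightarrow> 'v set \<Rightarrow> bool" where
  "independent_set E F \<longleftrightarrow> (\<forall>x\<in>F. \<forall>y\<in>F. {x, y} \<notin> E)"

definition max_independent_in :: "'v set set \<Rightarrow> 'v set \<Rightarrow> 'v set \<Rightarrow> bool" where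
  "max_independent_in E R L \<longleftrightarrow>
     L \<subseteq> R \<and> independent_set E L \<and> (\<forall>x\<in>R - L. \<exists>y\<in>L. {x, y} \<in> E)"

lemma simple_graph_edge: "simple_graph E \<Longrightarrow> e \<in> E \<Longrightarrow> \<exists>x y. x \<noteq> y \<and> e = {x, y}"
  unfolding simple_graph_def by (metis card_2_iff)

lemma independent_set_Un:
  "independent_set E (A \<union> B) \<longleftrightarrow>
     independent_set E A \<and> independent_set E B \<and> (\<forall>x\<in>A. \<forall>y\<in>B. {x, y} \<notin> E)"
proof -
  have "{x, y} \<in> E \<longleftrightarrow> {y, x} \<in> E" for x y
    by (simp add: insert_commute)
  then show ?thesis
    unfolding independent_set_def by blast
qed

lemma independent_set_subset: "independent_set E A \<Longrightarrow> B \<subseteq> A \<Longrightarrow> independent_set E B"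
  by (auto simp: independent_set_def)

lemma simple_graph_no_loop: "simple_graph E \<Longrightarrow> {x, x} \<notin> E"
  by (auto simp: simple_graph_def)

lemma max_independent_in_extend:
  fixes E :: "'v::finite set set"
  assumes "simple_graph E" "independent_set E F" "F \<subseteq> R"
  shows "\<exists>L. F \<subseteq> L \<and> max_independent_in E R L"
proof -
  define \<F> where "\<F> = {L. F \<subseteq> L \<and> L \<subseteq> R \<and> independent_set E L}"
  have "finite \<F>" "F \<in> \<F>"
    using assms by (auto simp: \<F>_def)
  from finite_has_maximal2[OF this] obtain L
    where L: "L \<in> \<F>" "\<And>L'. L' \<in> \<F> \<Longrightarrow> L \<subseteq> L' \<Longrightarrow> L = L'"
    by auto
  have "\<exists>y\<in>L. {x, y} \<in> E" if x: "x \<in> R - L" for x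
  proof (rule ccontr)
    assume none: "\<not> (\<exists>y\<in>L. {x, y} \<in> E)"
    have "independent_set E (insert x L)"
      using L(1) none simple_graph_no_loop[OF assms(1), of x]
      by (auto simp: \<F>_def independent_set_def insert_commute)
    then have "insert x L \<in> \<F>"
      using L(1) x by (auto simp: \<F>_def)
    from L(2)[OF this] x show False
      by blast
  qed
  with L(1) show ?thesis
    by (auto simp: \<F>_def max_independent_in_def)
qed

text \<open>A vertex outside \<open>L\<close> has a neighbour in \<open>L\<close>, and dropping it
  from the cover uncovers that edge. Through this lemma unmixedness becomes a statement on maximal
  independent sets.\<close>

lemma max_independent_complement:
  assumes E: "simple_graph E" and L: "max_independent_in E UNIV L"
  shows "minimal_vertex_cover E (- L)"
proof -
  have "vertex_cover E (- L)"
    unfolding vertex_cover_def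
  proof
    fix e assume "e \<in> E"
    with simple_graph_edge[OF E] obtain x y where "e = {x, y}" "{x, y} \<in> E"
      by blast
    then show "e \<inter> - L \<noteq> {}"
      using L by (auto simp: max_independent_in_def independent_set_def)
  qed
  moreover have "\<not> vertex_cover E D" if D: "D \<subset> - L" for D
  proof -
    from D obtain x where x: "x \<notin> L" "x \<notin> D"
      by blast
    then obtain y where y: "y \<in> L" "{x, y} \<in> E"
      using L by (auto simp: max_independent_in_def)
    have "{x, y} \<inter> D = {}"
      using x D y(1) by blast
    then show ?thesis
      unfolding vertex_cover_def using y(2) by blast
  qed
  ultimately show ?thesis
    by (auto simp: minimal_vertex_cover_def)
qed

lemma minimal_vertex_cover_exists:
  fixes E :: "'v::finite set set"
  assumes "simple_graph E"
  shows "\<exists>C. minimal_vertex_cover E C"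
  using max_independent_in_extend[OF assms, of "{}" UNIV] max_independent_complement[OF assms]
  by (auto simp: independent_set_def)

lemma minimal_vertex_cover_private_edge:
  assumes E: "simple_graph E" and C: "minimal_vertex_cover E C" and x: "x \<in> C"
  shows "\<exists>y. y \<notin> C \<and> {x, y} \<in> E"
proof -
  have "\<not> vertex_cover E (C - {x})"
    using C x by (auto simp: minimal_vertex_cover_def)
  then obtain e where e: "e \<in> E" "e \<inter> (C - {x}) = {}"
    by (auto simp: vertex_cover_def)
  with C have "x \<in> e"
    by (auto simp: minimal_vertex_cover_def vertex_cover_def)
  with simple_graph_edge[OF E e(1)] obtain y where "e = {x, y}" "x \<noteq> y"
    by auto
  with e show ?thesis
    by blast
qed

section \<open>Well-covered graphs without isolated vertices\<close>

text \<open>Hall's inequality by exchange. A maximal independent set \<open>T\<close> of neighbours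
  of \<open>I\<close> can be swapped for the part of \<open>I\<close> it dominates, which is thus no
  larger than \<open>T\<close>; the remainder of \<open>I\<close> is handled by induction, and its
  neighbours avoid \<open>T\<close>.\<close>

lemma well_covered_matching:
  fixes E :: "'v::finite set set"
  assumes E: "simple_graph E"
    and wc: "\<And>L. max_independent_in E R L \<Longrightarrow> card L = \<alpha>"
    and deg: "\<And>x. x \<in> R \<Longrightarrow> \<exists>y\<in>R. {x, y} \<in> E"
    and I: "I \<subseteq> R" "independent_set E I"
  shows "card I \<le> card {y \<in> R. \<exists>x\<in>I. {x, y} \<in> E}"
  using finite[of I] I
proof (induction I rule: finite_psubset_induct)
  case (psubset I)
  define N where "N J = {y \<in> R. \<exists>x\<in>J. {x, y} \<in> E}" for J
  have "card I \<le> card (N I)"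
  proof (cases "I = {}")
    case False
    then obtain x v where xv: "x \<in> I" "v \<in> R" "{x, v} \<in> E"
      using deg psubset.prems by blast
    have "independent_set E {v}" "{v} \<subseteq> N I"
      using xv simple_graph_no_loop[OF E, of v] by (auto simp: independent_set_def N_def)
    then obtain T where T: "v \<in> T" "max_independent_in E (N I) T"
      using max_independent_in_extend[OF E] by (meson insert_subset)
    \<comment> \<open>The part of \<open>I\<close> dominated by \<open>T\<close>. It contains
      \<open>x\<close>, because \<open>v\<close> lies in \<open>T\<close>, so the remainder
      \<open>I2\<close> is a proper subset.\<close>
    define I1 where "I1 = {i \<in> I. \<exists>t\<in>T. {i, t} \<in> E}"
    define I2 where "I2 = I - I1"
    have "independent_set E T" "T \<subseteq> R"
      using T(2) by (auto simp: max_independent_in_def N_def)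
    then have "independent_set E (I2 \<union> T)" "I2 \<union> T \<subseteq> R"
      using psubset.prems independent_set_subset[OF psubset.prems(2), of I2]
      by (auto simp: independent_set_Un I1_def I2_def)
    then obtain M where M: "I2 \<union> T \<subseteq> M" "max_independent_in E R M"
      using max_independent_in_extend[OF E] by meson
    \<comment> \<open>By maximality of \<open>T\<close>, the set \<open>M\<close> meets the
      neighbourhood of \<open>I\<close> only in \<open>T\<close>; hence \<open>M - T\<close> can be
      joined with all of \<open>I\<close>.\<close>
    have MT: "y \<in> T" if yM: "y \<in> M" and yN: "y \<in> N I" for y
    proof (rule ccontr)
      assume "y \<notin> T"
      then obtain t where "t \<in> T" "{y, t} \<in> E"
        using T(2) yN by (auto simp: max_independent_in_def)
      then show False
        using M T(2) yM by (auto simp: max_independent_in_def independent_set_def)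
    qed
    have "independent_set E (M - T \<union> I)"
    proof -
      have "{i, y} \<notin> E" if "i \<in> I" "y \<in> M - T" for i y
        using MT[of y] that M(2) by (auto simp: N_def max_independent_in_def)
      moreover have "independent_set E (M - T)"
        using M(2) independent_set_subset[of E M] by (auto simp: max_independent_in_def)
      ultimately have "independent_set E (I \<union> (M - T))"
        using psubset.prems(2) by (simp add: independent_set_Un)
      then show ?thesis
        by (simp add: Un_commute)
    qed
    moreover have "M - T \<union> I \<subseteq> R"
      using M(2) psubset.prems by (auto simp: max_independent_in_def)
    ultimately obtain M' where M': "M - T \<union> I \<subseteq> M'" "max_independent_in E R M'"
      using max_independent_in_extend[OF E] by meson
    \<comment> \<open>Replacing \<open>T\<close> by \<open>I1\<close> in \<open>M\<close> leaves an
      independent set, whose size is at most the common size of all maximal ones.\<close>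
    have "I1 \<inter> M = {}"
      using M T by (auto simp: I1_def max_independent_in_def independent_set_def)
    then have "card (M - T) + card I1 = card (M - T \<union> I1)"
      by (intro card_Un_disjoint[symmetric]) auto
    also have "\<dots> \<le> card M'"
      using M'(1) by (intro card_mono) (auto simp: I1_def)
    also have "\<dots> = card M"
      using wc M(2) M'(2) by simp
    also have "card M = card (M - T) + card T"
      using M(1) by (simp add: card_Diff_subset card_mono)
    finally have 1: "card I1 \<le> card T"
      by simp
    have "I2 \<subset> I"
      using xv T(1) by (auto simp: I2_def I1_def)
    moreover have "independent_set E I2"
      using psubset.prems by (auto simp: I2_def independent_set_def)
    ultimately have 2: "card I2 \<le> card (N I2)"
      using psubset.IH[of I2] psubset.prems by (auto simp: N_def)
    have "card I = card I1 + card I2"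
      by (subst card_Un_disjoint[symmetric]) (auto simp: I1_def I2_def intro!: arg_cong[where f = card])
    also have "\<dots> \<le> card T + card (N I2)"
      using 1 2 by simp
    also have "\<dots> = card (T \<union> N I2)"
      by (intro card_Un_disjoint[symmetric]) (auto simp: N_def I2_def I1_def)
    also have "\<dots> \<le> card (N I)"
      using T(2) by (intro card_mono) (auto simp: N_def I2_def max_independent_in_def)
    finally show ?thesis .
  qed simp
  then show ?case
    by (simp add: N_def)
qed

text \<open>A maximal independent set is disjoint from its neighbourhood, which is at least as
  large.\<close>

lemma well_covered_half:
  fixes E :: "'v::finite set set"
  assumes E: "simple_graph E"
    and wc: "\<And>L. max_independent_in E R L \<Longrightarrow> card L = \<alpha>"
    and deg: "\<And>x. x \<in> R \<Longrightarrow> \<exists>y\<in>R. {x, y} \<in> E"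
  shows "2 * \<alpha> \<le> card R"
proof -
  obtain L where L: "max_independent_in E R L"
    using max_independent_in_extend[OF E, of "{}" R] by (auto simp: independent_set_def)
  let ?N = "{y \<in> R. \<exists>x\<in>L. {x, y} \<in> E}"
  have "card L \<le> card ?N"
    using L by (intro well_covered_matching[OF E wc deg]) (auto simp: max_independent_in_def)
  then have "2 * card L \<le> card L + card ?N"
    by simp
  also have "\<dots> = card (L \<union> ?N)"
    using L by (intro card_Un_disjoint[symmetric]) (auto simp: max_independent_in_def independent_set_def)
  also have "\<dots> \<le> card R"
    using L by (intro card_mono) (auto simp: max_independent_in_def)
  finally show ?thesis
    using wc[OF L] by simp
qed

section \<open>Weights of minimal \<open>k\<close>-covers\<close>

text \<open>Here \<open>d\<close> is the common size of the minimal vertex covers. Two vertices of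
  value at most \<open>s - 1\<close> and \<open>t - 1\<close> sum to less than \<open>k\<close>, so
  \<open>P\<close> has no edge inside or to the band \<open>R\<close>; adding \<open>P\<close> turns
  maximal independent sets of \<open>R\<close> into maximal ones of the graph, and those of
  \<open>R\<close> have equal size.\<close>

lemma minimal_cover_level_sets:
  fixes E :: "'v::finite set set" and c :: "'v \<Rightarrow> nat"
  assumes E: "simple_graph E"
    and d: "\<And>L. max_independent_in E UNIV L \<Longrightarrow> card L + d = card (UNIV :: 'v set)"
    and cover: "\<And>x y. {x, y} \<in> E \<Longrightarrow> k \<le> c x + c y"
    and tight: "\<And>x. 0 < c x \<Longrightarrow> \<exists>y. {x, y} \<in> E \<and> c x + c y = k"
    and st: "s + t = Suc k" "1 \<le> s" "s \<le> t"
  shows "card {x. s \<le> c x} + card {x. t \<le> c x} \<le> 2 * d"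
proof -
  define P where "P = {x. c x < s}"
  define R where "R = {x. s \<le> c x \<and> c x < t}"
  define A where "A = {x. t \<le> c x}"
  have PL: "card P + card L + d = card (UNIV :: 'v set)" if L: "max_independent_in E R L" for L
  proof -
    have LR: "L \<subseteq> R"
      using L by (simp add: max_independent_in_def)
    have PPL: "{x, y} \<notin> E" if "x \<in> P" "y \<in> P \<union> L" for x y
    proof -
      have "c x + c y < k"
        using that LR st by (auto simp: P_def R_def)
      then show ?thesis
        using cover[of x y] by auto
    qed
    then have "independent_set E P"
      by (simp add: independent_set_def)
    then have "independent_set E (P \<union> L)"
      using L PPL by (simp add: max_independent_in_def independent_set_Un)
    moreover have "\<exists>y\<in>P \<union> L. {x, y} \<in> E" if "x \<in> UNIV - (P \<union> L)" for x
    proof (cases "x \<in> R")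
      case True
      then show ?thesis
        using L that by (auto simp: max_independent_in_def)
    next
      case False
      then have "t \<le> c x"
        using that by (auto simp: R_def P_def)
      \<comment> \<open>Tightness forces \<open>c y \<le> k - t = s - 1\<close>, so \<open>y\<close>
        lies in \<open>P\<close>.\<close>
      moreover obtain y where "{x, y} \<in> E" "c x + c y = k"
        using tight[of x] \<open>t \<le> c x\<close> st by auto
      ultimately show ?thesis
        using st by (intro bexI[of _ y]) (auto simp: P_def)
    qed
    ultimately have "max_independent_in E UNIV (P \<union> L)"
      by (simp add: max_independent_in_def)
    from d[OF this] show ?thesis
      using LR by (subst (asm) card_Un_disjoint) (auto simp: P_def R_def)
  qed
  obtain L where L: "max_independent_in E R L"
    using max_independent_in_extend[OF E, of "{}" R] by (auto simp: independent_set_def)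
  have "2 * card L \<le> card R"
  proof (rule well_covered_half[OF E])
    show "card L' = card L" if "max_independent_in E R L'" for L'
      using PL[OF that] PL[OF L] by simp
    fix x assume x: "x \<in> R"
    \<comment> \<open>The band is symmetric under \<open>r\<close> to \<open>k - r\<close>, because
      \<open>k = s + t - 1\<close>; so the tight neighbour of \<open>x\<close> is again in
      \<open>R\<close>.\<close>
    then obtain y where "{x, y} \<in> E" "c x + c y = k"
      using tight[of x] st by (auto simp: R_def)
    then show "\<exists>y\<in>R. {x, y} \<in> E"
      using x st by (intro bexI[of _ y]) (auto simp: R_def)
  qed
  moreover have "card P + card R + card A = card (UNIV :: 'v set)"
  proof -
    have "(UNIV :: 'v set) = (P \<union> R) \<union> A"
      using st by (auto simp: P_def R_def A_def)
    then have "card (UNIV :: 'v set) = card ((P \<union> R) \<union> A)"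
      by simp
    also have "\<dots> = card (P \<union> R) + card A"
      using st by (intro card_Un_disjoint) (auto simp: P_def R_def A_def)
    also have "card (P \<union> R) = card P + card R"
      by (subst card_Un_disjoint) (auto simp: P_def R_def)
    finally show ?thesis ..
  qed
  moreover have "card {x. s \<le> c x} = card R + card A"
  proof -
    have "{x. s \<le> c x} = R \<union> A"
      using st by (auto simp: R_def A_def)
    moreover have "card (R \<union> A) = card R + card A"
      by (intro card_Un_disjoint) (auto simp: R_def A_def)
    ultimately show ?thesis
      by simp
  qed
  \<comment> \<open>In sizes, \<open>d = R + A - L\<close> and \<open>2 L \<le> R\<close>, so
    \<open>2 d\<close> is at least \<open>R + 2 A\<close>, the sum of the two level sets.\<close>
  ultimately show ?thesis
    using PL[OF L] by (simp add: A_def)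
qed

text \<open>Tightness keeps \<open>c\<close> at most \<open>k\<close>, so the weight is the sum of
  the level set sizes for \<open>t\<close> from 1 to \<open>k\<close>. Adding the sum in reverse
  order pairs \<open>t\<close> with \<open>k + 1 - t\<close>.\<close>

lemma minimal_cover_weight:
  fixes E :: "'v::finite set set" and c :: "'v \<Rightarrow> nat"
  assumes E: "simple_graph E"
    and d: "\<And>L. max_independent_in E UNIV L \<Longrightarrow> card L + d = card (UNIV :: 'v set)"
    and cover: "\<And>x y. {x, y} \<in> E \<Longrightarrow> k \<le> c x + c y"
    and tight: "\<And>x. 0 < c x \<Longrightarrow> \<exists>y. {x, y} \<in> E \<and> c x + c y = k"
  shows "sum c UNIV \<le> k * d"
proof -
  define f where "f t = card {x. t \<le> c x}" for t
  have c: "c x = (\<Sum>t=1..k. if t \<le> c x then 1 else 0)" for x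
  proof -
    have "c x \<le> k"
      using tight[of x] by (cases "c x = 0") auto
    then have "{1..k} \<inter> {t. t \<le> c x} = {1..c x}"
      by auto
    then show ?thesis
      by (simp add: sum.If_cases)
  qed
  have "sum c UNIV = (\<Sum>x\<in>UNIV. \<Sum>t=1..k. if t \<le> c x then 1 else 0)"
    by (intro sum.cong refl c)
  also have "\<dots> = (\<Sum>t=1..k. f t)"
    by (subst sum.swap) (simp add: f_def sum.If_cases)
  finally have s: "sum c UNIV = (\<Sum>t=1..k. f t)" .
  have "2 * sum c UNIV = (\<Sum>t=1..k. f t) + (\<Sum>t=1..k. f (Suc k - t))"
    using s sum.atLeastAtMost_rev[of f 1 k] by simp
  also have "\<dots> = (\<Sum>t=1..k. f t + f (Suc k - t))"
    by (simp add: sum.distrib)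
  also have "\<dots> \<le> (\<Sum>t=1..k. 2 * d)"
  proof (rule sum_mono)
    fix t assume t: "t \<in> {1..k}"
    have *: "card {x. r \<le> c x} + card {x. u \<le> c x} \<le> 2 * d" if "r + u = Suc k" "1 \<le> r" "r \<le> u" for r u
      by (rule minimal_cover_level_sets[OF E d cover tight that])
    show "f t + f (Suc k - t) \<le> 2 * d"
    proof (cases "t \<le> Suc k - t")
      case True
      with *[of t "Suc k - t"] t show ?thesis
        by (simp add: f_def)
    next
      case False
      moreover have "1 \<le> Suc k - t"
        using t by auto
      ultimately show ?thesis
        using *[of "Suc k - t" t] t by (simp add: f_def)
    qed
  qed
  finally show ?thesis
    by simp
qed

text \<open>
  The hypothesis \<open>loose\<close> says that the upper Koszul complex of \<open>a\<close> has no cone point. Its facet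
  \<open>F = P \<union> L\<close> is an independent set of the graph, and subtracting it from \<open>a\<close> leaves a minimal
  \<open>k\<close>-cover.
\<close>

lemma no_cone_point_weight:
  fixes E :: "'v::finite set set" and a :: "'v \<Rightarrow> nat"
  assumes E: "simple_graph E"
    and d: "\<And>L. max_independent_in E UNIV L \<Longrightarrow> card L + d = card (UNIV :: 'v set)"
    and cover: "\<And>x y. {x, y} \<in> E \<Longrightarrow> k \<le> a x + a y"
    and loose: "\<And>x. a x = 0 \<or> (\<exists>y. {x, y} \<in> E \<and> a x + a y = k) \<or>
      (\<exists>y. {x, y} \<in> E \<and> a x + a y = Suc k \<and> 0 < a y \<and> (\<forall>z. {y, z} \<in> E \<longrightarrow> a y + a z \<noteq> k))"
  shows "sum a UNIV + d \<le> k * d + card (UNIV :: 'v set)"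
proof -
  \<comment> \<open>The vertices of the complex: lowering \<open>a\<close> by one at such an
    \<open>x\<close> still gives a \<open>k\<close>-cover.\<close>
  define U where "U = {x. 0 < a x \<and> (\<forall>z. {x, z} \<in> E \<longrightarrow> a x + a z \<noteq> k)}"
  \<comment> \<open>An edge at a vertex of \<open>U\<close> has sum at least \<open>k + 1\<close>.
    So vertices of \<open>U\<close> below \<open>(k + 1) / 2\<close> are adjacent neither to each
    other nor to those exactly at the half; edges within \<open>M\<close> are why only a maximal
    independent subset of \<open>M\<close> is added.\<close>
  define P where "P = {x \<in> U. 2 * a x < Suc k}"
  define M where "M = {x \<in> U. 2 * a x = Suc k}"
  obtain L where L: "max_independent_in E M L"
    using max_independent_in_extend[OF E, of "{}" M] by (auto simp: independent_set_def)
  define F where "F = P \<union> L"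
  have LM: "L \<subseteq> M"
    using L by (simp add: max_independent_in_def)
  have FU: "F \<subseteq> U"
    using LM by (auto simp: F_def P_def M_def)
  have U: "Suc k \<le> a x + a y" if "x \<in> U" "{x, y} \<in> E" for x y
    using that cover[of x y] by (auto simp: U_def Suc_le_eq le_neq_implies_less)
  have F: "independent_set E F"
  proof -
    have PPM: "{x, y} \<notin> E" if "x \<in> P" "y \<in> P \<union> M" for x y
      using U[of x y] that by (auto simp: P_def M_def)
    then have "independent_set E P"
      by (simp add: independent_set_def)
    then show ?thesis
      unfolding F_def independent_set_Un using L LM PPM by (auto simp: max_independent_in_def)
  qed
  define c where "c x = (if x \<in> F then a x - 1 else a x)" for x
  have "sum c UNIV \<le> k * d"
  proof (rule minimal_cover_weight[OF E d])
    fix x y assume xy: "{x, y} \<in> E"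
    then have "x \<notin> F \<or> y \<notin> F"
      using F by (auto simp: independent_set_def)
    then show "k \<le> c x + c y"
      using U[of x y] U[of y x] FU xy cover[of x y] by (auto simp: c_def insert_commute)
  next
    fix x assume cx: "0 < c x"
    then have ax: "0 < a x"
      by (auto simp: c_def split: if_splits)
    show "\<exists>y. {x, y} \<in> E \<and> c x + c y = k"
    proof (cases "x \<in> U")
      case False
      then obtain y where y: "{x, y} \<in> E" "a x + a y = k"
        using ax by (auto simp: U_def)
      then have "y \<notin> U"
        by (auto simp: U_def insert_commute add.commute)
      then show ?thesis
        using y False FU by (intro exI[of _ y]) (auto simp: c_def)
    next
      case True
      then obtain y where y: "{x, y} \<in> E" "a x + a y = Suc k" "y \<in> U"
        using loose[of x] by (auto simp: U_def)
      show ?thesis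
      proof (cases "x \<in> M - L")
        case True
        then obtain z where z: "z \<in> L" "{x, z} \<in> E"
          using L by (auto simp: max_independent_in_def)
        then have "z \<in> M" "z \<in> F" "x \<notin> F"
          using LM True by (auto simp: F_def P_def M_def)
        then show ?thesis
          using z True by (intro exI[of _ z]) (auto simp: c_def M_def)
      next
        case False
        \<comment> \<open>Both is impossible by independence. If neither lay in \<open>F\<close>,
          then \<open>x\<close> would be above \<open>(k + 1) / 2\<close> and \<open>y\<close> below
          it, hence in \<open>P\<close>.\<close>
        have "(x \<in> F) \<noteq> (y \<in> F)"
        proof
          assume eq: "(x \<in> F) = (y \<in> F)"
          then have "x \<notin> F" "y \<notin> F"
            using F y(1) by (auto simp: independent_set_def)
          then show False
            using y True False by (auto simp: F_def P_def M_def)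
        qed
        then show ?thesis
          using y ax by (intro exI[of _ y]) (auto simp: c_def U_def)
      qed
    qed
  qed
  moreover have "sum a UNIV = sum c UNIV + card F"
  proof -
    have "a x = c x + (if x \<in> F then 1 else 0)" for x
      using FU by (auto simp: c_def U_def)
    then have "sum a UNIV = (\<Sum>x\<in>UNIV. c x + (if x \<in> F then 1 else 0))"
      by presburger
    then show ?thesis
      by (simp add: sum.distrib sum.If_cases)
  qed
  moreover have "card F + d \<le> card (UNIV :: 'v set)"
  proof -
    obtain L' where L': "F \<subseteq> L'" "max_independent_in E UNIV L'"
      using max_independent_in_extend[OF E F, of UNIV] by auto
    then show ?thesis
      using d[OF L'(2)] card_mono[of L' F] by simp
  qed
  ultimately show ?thesis
    by simp
qed

section \<open>Regularity from Koszul homology\<close>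

definition fun_of_vec :: "'r::zero vec \<Rightarrow> nat \<Rightarrow> 'r" where
  "fun_of_vec v i = (if i < dim_vec v then v $ i else 0)"

definition fun_of_mat :: "'r::zero mat \<Rightarrow> nat \<Rightarrow> nat \<Rightarrow> 'r" where
  "fun_of_mat A i b = (if i < dim_row A \<and> b < dim_col A then A $$ (i, b) else 0)"

text \<open>The augmentation as a matrix with a single row, mapping to the free module with shift
  list \<open>[0]\<close>.\<close>

definition fun_of_row :: "'r::zero vec \<Rightarrow> nat \<Rightarrow> nat \<Rightarrow> 'r" where
  "fun_of_row v i b = (if i = 0 then fun_of_vec v b else 0)"

lemma fun_of_vec_image: "fun_of_vec ` carrier_vec n = (fvec n :: (nat \<Rightarrow> 'r::zero) set)"
proof
  show "(fvec n :: (nat \<Rightarrow> 'r) set) \<subseteq> fun_of_vec ` carrier_vec n"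
  proof
    fix f :: "nat \<Rightarrow> 'r" assume "f \<in> fvec n"
    then have "f = fun_of_vec (vec n f)"
      by (auto simp: fun_of_vec_def fvec_def fun_eq_iff)
    then show "f \<in> fun_of_vec ` carrier_vec n"
      by (metis imageI vec_carrier)
  qed
qed (auto simp: fvec_def fun_of_vec_def)

lemma inj_on_fun_of_vec: "inj_on fun_of_vec (carrier_vec n)"
proof (rule inj_onI)
  fix v w :: "'a vec"
  assume *: "v \<in> carrier_vec n" "w \<in> carrier_vec n" "fun_of_vec v = fun_of_vec w"
  show "v = w"
  proof (rule eq_vecI)
    fix i assume "i < dim_vec w"
    moreover have "fun_of_vec v i = fun_of_vec w i"
      by (simp only: *(3))
    ultimately show "v $ i = w $ i"
      using *(1,2) by (simp add: fun_of_vec_def)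
  qed (use * in auto)
qed

lemma fun_of_vec_mult_mat:
  assumes "A \<in> carrier_mat m n" "v \<in> carrier_vec n"
  shows "fun_of_vec (A *\<^sub>v v) = mat_app n (fun_of_mat A) (fun_of_vec v)"
  using assms
  by (auto simp: fun_of_vec_def fun_of_mat_def mat_app_def scalar_prod_def fun_eq_iff
      lessThan_atLeast0 intro!: sum.cong)

lemma mat_app_fun_of_row:
  assumes "e \<in> carrier_vec n" "v \<in> carrier_vec n"
  shows "mat_app n (fun_of_row e) (fun_of_vec v) = (\<lambda>i. if i = 0 then e \<bullet> v else 0)"
  using assms
  by (auto simp: fun_of_vec_def fun_of_row_def mat_app_def scalar_prod_def fun_eq_iff
      lessThan_atLeast0 intro!: sum.cong)

lemma kernel_fun_of_mat:
  assumes "A \<in> carrier_mat m n"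
  shows "{f \<in> fvec n. mat_app n (fun_of_mat A) f = (\<lambda>_. 0)} = fun_of_vec ` mat_kernel A"
proof -
  have "A *\<^sub>v v = 0\<^sub>v m \<longleftrightarrow> mat_app n (fun_of_mat A) (fun_of_vec v) = (\<lambda>_. 0)" if "v \<in> carrier_vec n" for v
  proof -
    have "A *\<^sub>v v = 0\<^sub>v m \<longleftrightarrow> fun_of_vec (A *\<^sub>v v) = fun_of_vec (0\<^sub>v m)"
      using assms that by (intro inj_on_eq_iff[OF inj_on_fun_of_vec[of m], symmetric]) auto
    also have "fun_of_vec (0\<^sub>v m) = (\<lambda>_. 0)"
      by (auto simp: fun_of_vec_def)
    finally show ?thesis
      using fun_of_vec_mult_mat[OF assms that] by simp
  qed
  then show ?thesis
    unfolding fun_of_vec_image[symmetric] mat_kernel[OF assms] by auto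
qed

lemma image_fun_of_mat:
  assumes "A \<in> carrier_mat m n"
  shows "mat_app n (fun_of_mat A) ` fvec n = fun_of_vec ` {A *\<^sub>v w | w. w \<in> carrier_vec n}"
  unfolding fun_of_vec_image[symmetric]
  using fun_of_vec_mult_mat[OF assms] by (auto simp: image_iff) metis+

lemma all_nat_iff: "(\<forall>i. P i) \<longleftrightarrow> P 0 \<and> (\<forall>i. P (Suc i))"
  by (metis not0_implies_Suc)

text \<open>Prepending \<open>[0]\<close> and the row of \<open>\<epsilon>\<close> makes the
  augmentation the zeroth map of a uniform sequence. Images and kernels transfer because
  \<open>fun_of_vec\<close> is injective on vectors of fixed length.\<close>

lemma minimal_graded_free_resolution_iff:
  fixes I :: "('v::finite, 'k::field) mpoly set"
  assumes e: "\<epsilon> \<in> carrier_vec (length (s 0))"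
    and \<phi>: "\<And>i. \<phi> i \<in> carrier_mat (length (s i)) (length (s (Suc i)))"
  shows "minimal_graded_free_resolution I s \<epsilon> \<phi> \<longleftrightarrow>
    minimal_resolution I (case_nat [0] s) (case_nat (fun_of_row \<epsilon>) (\<lambda>i. fun_of_mat (\<phi> i)))"
proof -
  let ?n = "\<lambda>i. length (s i)"
  define \<iota> where "\<iota> p i = (if i = 0 then p else 0)" for p :: "('v, 'k) mpoly" and i :: nat
  have inj: "inj \<iota>"
    by (auto simp: inj_def \<iota>_def fun_eq_iff dest: spec[of _ 0])
  have g0: "graded_mat [0] (s 0) (fun_of_row \<epsilon>) \<longleftrightarrow> (\<forall>b<?n 0. homogeneous (int (s 0 ! b)) (\<epsilon> $ b))"
    using e by (auto simp: graded_mat_def fun_of_row_def fun_of_vec_def)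
  have g: "graded_mat (s i) (s (Suc i)) (fun_of_mat (\<phi> i)) \<longleftrightarrow>
      (\<forall>a<?n i. \<forall>b<?n (Suc i). homogeneous (int (s (Suc i) ! b) - int (s i ! a)) (\<phi> i $$ (a, b)))" for i
    using \<phi>[of i] by (auto simp: graded_mat_def fun_of_mat_def)
  have im0: "mat_app (?n 0) (fun_of_row \<epsilon>) ` fvec (?n 0) = ideal_vecs I \<longleftrightarrow>
      {\<epsilon> \<bullet> v | v. v \<in> carrier_vec (?n 0)} = I"
  proof -
    have "mat_app (?n 0) (fun_of_row \<epsilon>) ` fvec (?n 0) = \<iota> ` {\<epsilon> \<bullet> v | v. v \<in> carrier_vec (?n 0)}"
      unfolding fun_of_vec_image[symmetric] image_image \<iota>_def
      using mat_app_fun_of_row[OF e] by (auto simp: image_iff)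
    moreover have "ideal_vecs I = \<iota> ` I"
    proof
      show "ideal_vecs I \<subseteq> \<iota> ` I"
      proof
        fix f assume "f \<in> ideal_vecs I"
        then have "f 0 \<in> I" "f = \<iota> (f 0)"
          by (auto simp: ideal_vecs_def fvec_def \<iota>_def fun_eq_iff)
        then show "f \<in> \<iota> ` I"
          by blast
      qed
    qed (auto simp: ideal_vecs_def \<iota>_def fvec_def)
    ultimately show ?thesis
      using inj_image_eq_iff[OF inj] by simp
  qed
  have ker0: "{f \<in> fvec (?n 0). mat_app (?n 0) (fun_of_row \<epsilon>) f = (\<lambda>_. 0)} =
      fun_of_vec ` {v \<in> carrier_vec (?n 0). \<epsilon> \<bullet> v = 0}"
  proof -
    have "mat_app (?n 0) (fun_of_row \<epsilon>) (fun_of_vec v) = (\<lambda>_. 0) \<longleftrightarrow> \<epsilon> \<bullet> v = 0"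
      if "v \<in> carrier_vec (?n 0)" for v
      unfolding mat_app_fun_of_row[OF e that] by (auto simp: fun_eq_iff)
    then show ?thesis
      unfolding fun_of_vec_image[symmetric] by auto
  qed
  have ex0: "{f \<in> fvec (?n 0). mat_app (?n 0) (fun_of_row \<epsilon>) f = (\<lambda>_. 0)} =
      mat_app (?n (Suc 0)) (fun_of_mat (\<phi> 0)) ` fvec (?n (Suc 0)) \<longleftrightarrow>
      {v \<in> carrier_vec (?n 0). \<epsilon> \<bullet> v = 0} = {\<phi> 0 *\<^sub>v w | w. w \<in> carrier_vec (?n (Suc 0))}"
    unfolding ker0 image_fun_of_mat[OF \<phi>[of 0]]
    using \<phi>[of 0] by (intro inj_on_image_eq_iff[OF inj_on_fun_of_vec[of "?n 0"]]) auto
  have ex: "{f \<in> fvec (?n (Suc i)). mat_app (?n (Suc i)) (fun_of_mat (\<phi> i)) f = (\<lambda>_. 0)} =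
      mat_app (?n (Suc (Suc i))) (fun_of_mat (\<phi> (Suc i))) ` fvec (?n (Suc (Suc i))) \<longleftrightarrow>
      mat_kernel (\<phi> i) = {\<phi> (Suc i) *\<^sub>v w | w. w \<in> carrier_vec (?n (Suc (Suc i)))}" for i
    unfolding kernel_fun_of_mat[OF \<phi>] image_fun_of_mat[OF \<phi>]
    using \<phi>[of i] \<phi>[of "Suc i"]
    by (intro inj_on_image_eq_iff[OF inj_on_fun_of_vec[of "?n (Suc i)"]]) (auto simp: mat_kernel_def)
  have m: "(\<forall>a b. coef (fun_of_mat (\<phi> i) a b) 0 = 0) \<longleftrightarrow>
      (\<forall>a<?n i. \<forall>b<?n (Suc i). \<phi> i $$ (a, b) \<in> maximal_homogeneous_ideal)" for i
    using \<phi>[of i] by (auto simp: fun_of_mat_def maximal_homogeneous_ideal_iff)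
  let ?t = "case_nat [0] s" and ?B = "case_nat (fun_of_row \<epsilon>) (\<lambda>i. fun_of_mat (\<phi> i))"
  have "(\<forall>i. graded_mat (?t i) (?t (Suc i)) (?B i)) \<longleftrightarrow>
      (\<forall>b<?n 0. homogeneous (int (s 0 ! b)) (\<epsilon> $ b)) \<and>
      (\<forall>i. \<forall>a<?n i. \<forall>b<?n (Suc i). homogeneous (int (s (Suc i) ! b) - int (s i ! a)) (\<phi> i $$ (a, b)))"
    by (subst all_nat_iff) (simp add: g0 g)
  moreover have "(\<forall>i. {f \<in> fvec (length (?t (Suc i))). mat_app (length (?t (Suc i))) (?B i) f = (\<lambda>_. 0)} =
        mat_app (length (?t (Suc (Suc i)))) (?B (Suc i)) ` fvec (length (?t (Suc (Suc i))))) \<longleftrightarrow>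
      {v \<in> carrier_vec (?n 0). \<epsilon> \<bullet> v = 0} = {\<phi> 0 *\<^sub>v w | w. w \<in> carrier_vec (?n (Suc 0))} \<and>
      (\<forall>i. mat_kernel (\<phi> i) = {\<phi> (Suc i) *\<^sub>v w | w. w \<in> carrier_vec (?n (Suc (Suc i)))})"
    by (subst all_nat_iff) (simp add: ex0 ex)
  moreover have "(\<forall>i a b. coef (?B (Suc i) a b) 0 = 0) \<longleftrightarrow>
      (\<forall>i. \<forall>a<?n i. \<forall>b<?n (Suc i). \<phi> i $$ (a, b) \<in> maximal_homogeneous_ideal)"
    by (simp add: m)
  ultimately have "minimal_resolution I ?t ?B \<longleftrightarrow>
      (\<forall>b<?n 0. homogeneous (int (s 0 ! b)) (\<epsilon> $ b)) \<and>
      (\<forall>i. \<forall>a<?n i. \<forall>b<?n (Suc i). homogeneous (int (s (Suc i) ! b) - int (s i ! a)) (\<phi> i $$ (a, b))) \<and>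
      {\<epsilon> \<bullet> v | v. v \<in> carrier_vec (?n 0)} = I \<and>
      {v \<in> carrier_vec (?n 0). \<epsilon> \<bullet> v = 0} = {\<phi> 0 *\<^sub>v w | w. w \<in> carrier_vec (?n (Suc 0))} \<and>
      (\<forall>i. mat_kernel (\<phi> i) = {\<phi> (Suc i) *\<^sub>v w | w. w \<in> carrier_vec (?n (Suc (Suc i)))}) \<and>
      (\<forall>i. \<forall>a<?n i. \<forall>b<?n (Suc i). \<phi> i $$ (a, b) \<in> maximal_homogeneous_ideal)"
    unfolding minimal_resolution_def using im0 by simp
  then show ?thesis
    using e \<phi> by (simp add: minimal_graded_free_resolution_def graded_free_resolution_def)
qed

lemma minimal_graded_free_resolution_carrier:
  assumes "minimal_graded_free_resolution I s \<epsilon> \<phi>"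
  shows "\<epsilon> \<in> carrier_vec (length (s 0))" "\<phi> i \<in> carrier_mat (length (s i)) (length (s (Suc i)))"
  using assms by (auto simp: minimal_graded_free_resolution_def graded_free_resolution_def)

lemma minimal_graded_free_resolution_exists:
  fixes I :: "('v::finite, 'k::field) mpoly set"
  assumes "minimal_resolution I t B"
  shows "\<exists>s \<epsilon> \<phi>. minimal_graded_free_resolution I s \<epsilon> \<phi>"
proof -
  define s where "s i = t (Suc i)" for i
  define \<epsilon> where "\<epsilon> = vec (length (s 0)) (\<lambda>b. B 0 0 b)"
  define \<phi> where "\<phi> i = mat (length (s i)) (length (s (Suc i))) (\<lambda>(a, b). B (Suc i) a b)" for i
  have t0: "t 0 = [0]" and gr: "graded_mat (t i) (t (Suc i)) (B i)" for i
    using assms by (auto simp: minimal_resolution_def)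
  have "case_nat [0] s = t"
    by (auto simp: s_def t0 fun_eq_iff split: nat.split)
  moreover have "case_nat (fun_of_row \<epsilon>) (\<lambda>i. fun_of_mat (\<phi> i)) i a b = B i a b" for i a b
  proof (cases i)
    case 0
    then show ?thesis
      using gr[of 0] by (auto simp: graded_mat_def t0 fun_of_row_def fun_of_vec_def \<epsilon>_def s_def)
  next
    case (Suc i')
    then show ?thesis
      using gr[of i] by (auto simp: graded_mat_def fun_of_mat_def \<phi>_def s_def)
  qed
  then have "case_nat (fun_of_row \<epsilon>) (\<lambda>i. fun_of_mat (\<phi> i)) = B"
    by (simp add: fun_eq_iff)
  ultimately have "minimal_graded_free_resolution I s \<epsilon> \<phi>"
    using assms by (subst minimal_graded_free_resolution_iff) (auto simp: \<epsilon>_def \<phi>_def)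
  then show ?thesis
    by blast
qed

section \<open>Bounds on the regularity\<close>

text \<open>There are no exterior monomials on more than \<open>|V|\<close> factors. This bounds the
  length of a minimal resolution and makes the maximum defining the regularity one over a finite
  set.\<close>

lemma koszul_exact_beyond_card:
  fixes Z :: "(nat \<Rightarrow> ('v::finite, 'k::field) mpoly) set"
  assumes "card (UNIV :: 'v set) < p" "(\<lambda>_. 0) \<in> Z"
  shows "koszul_exact s Z p j"
  unfolding koszul_exact_def
proof (intro allI impI)
  fix C :: "nat \<Rightarrow> 'v set \<Rightarrow> ('v, 'k) mpoly"
  assume "koszul_chain s Z p j C"
  moreover have "card G \<noteq> p" for G :: "'v set"
    using assms(1) card_mono[of UNIV G] by auto
  ultimately have "C i G = 0" for i G
    by (simp add: koszul_chain_def)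
  then show "\<exists>W. koszul_chain s Z (Suc p) j W \<and> (\<forall>i. kbd (W i) = C i)"
    using assms(2) by (intro exI[of _ "\<lambda>_ _. 0"]) (auto simp: koszul_chain_def fun_eq_iff)
qed

text \<open>The Betti numbers come from an unspecified minimal resolution, so \<open>gen\<close>
  speaks of all of them, and \<open>ex\<close> serves both to produce one and to bound its
  shifts.\<close>

lemma regularity_bounds:
  fixes I :: "('v::finite, 'k::field) mpoly set"
  assumes I: "graded_submodule [0] (ideal_vecs I)"
    and ex: "\<And>p j. j > int N + int p \<Longrightarrow> koszul_exact [0] (ideal_vecs I) p j"
    and gen: "\<And>s \<epsilon> \<phi>. minimal_graded_free_resolution I s \<epsilon> \<phi> \<Longrightarrow> D \<in> set (s 0)"
  shows "int D \<le> regularity I \<and> regularity I \<le> int N"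
proof -
  obtain t B where "minimal_resolution I t B"
    using minimal_resolution_exists[OF I ex] by blast
  then obtain s0 \<epsilon>0 \<phi>0 where "minimal_graded_free_resolution I s0 \<epsilon>0 \<phi>0"
    using minimal_graded_free_resolution_exists by blast
  then have "\<exists>\<beta> s \<epsilon> \<phi>. minimal_graded_free_resolution I s \<epsilon> \<phi> \<and> (\<forall>i j. \<beta> i j = count_list (s i) j)"
    by (intro exI[of _ "\<lambda>i. count_list (s0 i)"] exI conjI) auto
  then have "\<exists>s \<epsilon> \<phi>. minimal_graded_free_resolution I s \<epsilon> \<phi> \<and>
      (\<forall>i j. graded_betti I i j = count_list (s i) j)"
    unfolding graded_betti_def by (rule someI_ex)
  then obtain s \<epsilon> \<phi> where res: "minimal_graded_free_resolution I s \<epsilon> \<phi>"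
    and \<beta>: "\<And>i j. graded_betti I i j = count_list (s i) j"
    by blast
  note carrier = minimal_graded_free_resolution_carrier[OF res]
  have nex: "\<not> koszul_exact [0] (ideal_vecs I) i (int j)" if "j \<in> set (s i)" for i j
    using minimal_resolution_not_koszul_exact[OF res[unfolded minimal_graded_free_resolution_iff[OF carrier]], of j i]
      that by simp
  define X where "X = {int j - int i | i j. graded_betti I i j \<noteq> 0}"
  have X: "X = {int j - int i | i j. j \<in> set (s i)}"
    by (simp add: X_def \<beta> count_list_0_iff)
  have "X \<subseteq> (\<Union>i\<le>card (UNIV :: 'v set). (\<lambda>j. int j - int i) ` set (s i))"
  proof
    fix r assume "r \<in> X"
    then obtain i j where ij: "r = int j - int i" "j \<in> set (s i)"
      by (auto simp: X)
    have "(\<lambda>_. 0) \<in> ideal_vecs I"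
      using I by (simp add: graded_submodule_def)
    then have "i \<le> card (UNIV :: 'v set)"
      using nex[OF ij(2)] koszul_exact_beyond_card[of i "ideal_vecs I" "[0]" "int j"] by (meson not_le)
    with ij show "r \<in> (\<Union>i\<le>card (UNIV :: 'v set). (\<lambda>j. int j - int i) ` set (s i))"
      by blast
  qed
  then have fin: "finite X"
    by (rule finite_subset) auto
  have mem: "int D \<in> X"
    using gen[OF res] by (force simp: X)
  have "r \<le> int N" if "r \<in> X" for r
  proof -
    from that obtain i j where ij: "r = int j - int i" "j \<in> set (s i)"
      by (auto simp: X)
    then show ?thesis
      using nex[OF ij(2)] ex[of i "int j"] by force
  qed
  moreover have "regularity I = Max X"
    by (simp add: regularity_def X_def)
  ultimately show ?thesis
    using fin mem by (auto intro!: Max_ge Max.boundedI)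
qed

section \<open>Monomial ideals\<close>

definition polys_on :: "'v monom set \<Rightarrow> ('v, 'k::field) mpoly set" where
  "polys_on U = {p. supp p \<subseteq> U}"

lemma graded_submodule_polys_on:
  assumes "monomial_set U"
  shows "graded_submodule [0] (ideal_vecs (polys_on U :: ('v::finite, 'k::field) mpoly set))"
  unfolding graded_submodule_def
proof (intro conjI ballI allI)
  fix r :: "('v, 'k) mpoly" and f g :: "nat \<Rightarrow> ('v, 'k) mpoly" and j
  assume f: "f \<in> ideal_vecs (polys_on U)"
  have "a + b \<in> U" if "b \<in> supp (f 0)" for a b
    using that f assms add.commute[of a b] by (auto simp: monomial_set_def ideal_vecs_def polys_on_def)
  then have "supp (r * f 0) \<subseteq> U"
    using keys_mult[of r "f 0"] by auto
  with f show "(\<lambda>i. r * f i) \<in> ideal_vecs (polys_on U)"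
    by (simp add: ideal_vecs_def polys_on_def fvec_def)
  have "supp (hcomp d (f 0)) \<subseteq> U" for d
    using f by (auto simp: ideal_vecs_def polys_on_def in_keys_iff coef_hcomp split: if_splits)
  with f show "(\<lambda>i. hcomp (j - int ([0] ! i)) (f i)) \<in> ideal_vecs (polys_on U)"
    by (simp add: ideal_vecs_def polys_on_def fvec_def)
  assume "g \<in> ideal_vecs (polys_on U)"
  with f show "(\<lambda>i. f i + g i) \<in> ideal_vecs (polys_on U)"
    using keys_add[of "f 0" "g 0"] by (auto simp: ideal_vecs_def polys_on_def fvec_def)
qed (auto simp: ideal_vecs_def polys_on_def fvec_def)

lemma koszul_exact_polys_on:
  assumes cone: "\<And>a. int (monom_degree a) = j \<Longrightarrow>
      \<exists>x. \<forall>F b. card F = p \<longrightarrow> a = b + set_monom F \<longrightarrow> b \<in> U \<longrightarrow> x \<notin> F \<longrightarrow>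
        expo b x \<noteq> 0 \<and> b - var_monom x \<in> U"
  shows "koszul_exact [0] (ideal_vecs (polys_on U :: ('v::finite, 'k::field) mpoly set)) p j"
  unfolding koszul_exact_def
proof (intro allI impI)
  fix C :: "nat \<Rightarrow> 'v set \<Rightarrow> ('v, 'k) mpoly"
  assume C: "koszul_chain [0] (ideal_vecs (polys_on U)) p j C" and cycle: "\<forall>i G. kbd (C i) G = 0"
  have "\<exists>w. (\<forall>G. card G \<noteq> Suc p \<longrightarrow> w G = 0) \<and> (\<forall>G. supp (w G) \<subseteq> U) \<and>
      (\<forall>G. homogeneous (j - int p - 1) (w G)) \<and> kbd w = C 0"
  proof (rule koszul_exact_monomial[where p = p])
    fix G
    show "kbd (C 0) G = 0"
      using cycle by simp
    show "supp (C 0 G) \<subseteq> U" "card G \<noteq> p \<Longrightarrow> C 0 G = 0"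
      using C by (auto simp: koszul_chain_def ideal_vecs_def polys_on_def)
    have "homogeneous (j - int ([0] ! 0) - int p) (C 0 G)"
      using C unfolding koszul_chain_def by blast
    then show "homogeneous (j - int p) (C 0 G)"
      by simp
  qed (use cone in simp)
  then obtain w where w: "\<And>G. card G \<noteq> Suc p \<Longrightarrow> w G = 0" "\<And>G. supp (w G) \<subseteq> U"
    "\<And>G. homogeneous (j - int p - 1) (w G)" "kbd w = C 0"
    by blast
  define W where "W i = (if i = 0 then w else (\<lambda>_. 0))" for i :: nat
  have "C i G = 0" if "i \<noteq> 0" for i G
    using C that by (auto simp: koszul_chain_def ideal_vecs_def fvec_def)
  then have "kbd (W i) = C i" for i
    using w(4) by (auto simp: W_def fun_eq_iff)
  moreover have "koszul_chain [0] (ideal_vecs (polys_on U)) (Suc p) j W"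
    using w by (auto simp: koszul_chain_def W_def ideal_vecs_def polys_on_def fvec_def algebra_simps)
  ultimately show "\<exists>W. koszul_chain [0] (ideal_vecs (polys_on U)) (Suc p) j W \<and> (\<forall>i. kbd (W i) = C i)"
    by blast
qed

text \<open>Writing the monomial \<open>m\<close> through the entries of \<open>\<epsilon>\<close>,
  some entry has a term dividing \<open>m\<close>. That term lies in \<open>U\<close>, so it is
  \<open>m\<close> by minimality, and homogeneity gives the entry the degree of
  \<open>m\<close>.\<close>

lemma minimal_generator_degree:
  fixes U :: "'v::finite monom set"
  assumes res: "minimal_graded_free_resolution (polys_on U :: ('v, 'k::field) mpoly set) s \<epsilon> \<phi>"
    and m: "m \<in> U" and min: "\<And>t u. t \<in> U \<Longrightarrow> m = t + u \<Longrightarrow> t = m"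
  shows "monom_degree m \<in> set (s 0)"
proof -
  let ?n = "length (s 0)"
  have e: "\<epsilon> \<in> carrier_vec ?n"
    using minimal_graded_free_resolution_carrier(1)[OF res] .
  have im: "{\<epsilon> \<bullet> v | v. v \<in> carrier_vec ?n} = polys_on U"
    and hom: "\<And>b. b < ?n \<Longrightarrow> homogeneous (int (s 0 ! b)) (\<epsilon> $ b)"
    using res by (auto simp: minimal_graded_free_resolution_def graded_free_resolution_def)
  have "(monom_poly m :: ('v, 'k) mpoly) \<in> polys_on U"
    using m by (simp add: polys_on_def monom_poly_def)
  then obtain v where v: "v \<in> carrier_vec ?n" "monom_poly m = \<epsilon> \<bullet> v"
    unfolding im[symmetric] by blast
  have "coef (\<epsilon> \<bullet> v) m = 1"
    by (simp flip: v(2) add: monom_poly_def)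
  then have "(\<Sum>b<?n. coef (\<epsilon> $ b * v $ b) m) = 1"
    using v(1) by (simp add: scalar_prod_def lookup_sum lessThan_atLeast0)
  then obtain b where b: "b < ?n" "coef (\<epsilon> $ b * v $ b) m \<noteq> 0"
    by (metis (mono_tags) lessThan_iff sum.neutral zero_neq_one)
  then obtain t u where tu: "m = t + u" "t \<in> supp (\<epsilon> $ b)"
    using keys_mult[of "\<epsilon> $ b" "v $ b"] by (auto simp: in_keys_iff)
  have "\<epsilon> \<bullet> unit_vec ?n b \<in> polys_on U"
    unfolding im[symmetric] by (auto intro!: exI[of _ "unit_vec ?n b"])
  then have "t \<in> U"
    using tu(2) e b(1) by (auto simp: polys_on_def scalar_prod_right_unit)
  then have "t = m"
    using min tu(1) by blast
  then have "int (monom_degree m) = int (s 0 ! b)"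
    using hom[OF b(1)] tu(2) by (auto simp: homogeneous_def)
  then show ?thesis
    using b(1) by simp
qed

text \<open>Any other monomial generating set contains \<open>M\<close>: an element of
  \<open>M\<close> is divisible by one of \<open>M'\<close>, which is divisible by one of
  \<open>M\<close>, and the antichain condition makes all three equal. This is the uniqueness behind
  the definite description.\<close>

lemma minimal_monomial_generators_eq:
  fixes I :: "('v, 'k::field) mpoly set"
  assumes gen: "ideal_of (monom_poly ` M) = I"
    and antichain: "\<And>m n r. m \<in> M \<Longrightarrow> n \<in> M \<Longrightarrow> m = n + r \<Longrightarrow> m = n"
  shows "minimal_monomial_generators I = M"
  unfolding minimal_monomial_generators_def
proof (rule the_equality)
  have in_I: "\<exists>n\<in>N. \<exists>r. m = n + r" if "ideal_of (monom_poly ` N) = I" "ideal_of (monom_poly ` N') = I" "m \<in> N'"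
    for N N' m
    using that monom_poly_in_monomial_ideal_iff[of m N, where 'k = 'k] ideal_of_base[of "monom_poly m" "monom_poly ` N'"]
    by auto
  have "ideal_of (monom_poly ` N) \<noteq> I" if "N \<subset> M" for N
  proof
    assume N: "ideal_of (monom_poly ` N) = I"
    obtain m where m: "m \<in> M" "m \<notin> N"
      using \<open>N \<subset> M\<close> by blast
    obtain n r where n: "n \<in> N" "m = n + r"
      using in_I[OF N gen m(1)] by blast
    then have "n \<in> M"
      using \<open>N \<subset> M\<close> by blast
    then have "m = n"
      using antichain[OF m(1)] n(2) by blast
    with n(1) m(2) show False
      by simp
  qed
  with gen show "minimal_monomial_generating_set I M"
    by (simp add: minimal_monomial_generating_set_def)
  fix M' assume M': "minimal_monomial_generating_set I M'"
  then have gen': "ideal_of (monom_poly ` M') = I"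
    by (simp add: minimal_monomial_generating_set_def)
  have "M \<subseteq> M'"
  proof
    fix m assume m: "m \<in> M"
    then obtain m' r where m': "m' \<in> M'" "m = m' + r"
      using in_I[OF gen' gen] by blast
    then obtain n r' where n: "n \<in> M" "m' = n + r'"
      using in_I[OF gen gen'] by blast
    have "m = n"
      by (rule antichain[OF m n(1), of "r' + r"]) (simp add: m'(2) n(2) add.assoc)
    then have "n + (r' + r) = n + 0"
      using m'(2) n(2) by (simp add: add.assoc)
    then have "r' + r = 0"
      by (simp only: add_left_cancel)
    then have "expo (r' + r) x = 0" for x
      by simp
    then have "r = 0"
      by (intro poly_mapping_eqI) (simp add: lookup_add)
    with m' show "m \<in> M'"
      by simp
  qed
  with M' gen show "M' = M"
    by (auto simp: minimal_monomial_generating_set_def)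
qed

section \<open>Symbolic powers of cover ideals\<close>

definition cover_monoms :: "'v set set \<Rightarrow> nat \<Rightarrow> 'v monom set" where
  "cover_monoms E k = {m. \<forall>x y. {x, y} \<in> E \<longrightarrow> k \<le> expo m x + expo m y}"

lemma monomial_set_cover_monoms: "monomial_set (cover_monoms E k)"
  by (fastforce simp: monomial_set_def cover_monoms_def lookup_add)

text \<open>Each factor contributes at least 1 to the degree in \<open>x\<close> and
  \<open>y\<close>; conversely \<open>k\<close> variables can be split off a monomial one by one.
  For \<open>x = y\<close> the exponent would be counted twice.\<close>

lemma ideal_power_edge:
  assumes "x \<noteq> y"
  shows "(p :: ('v, 'k::field) mpoly) \<in> ideal_power (ideal_of (var ` {x, y})) k \<longleftrightarrow>
    (\<forall>m\<in>supp p. k \<le> expo m x + expo m y)"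
proof -
  define U where "U k = {m. k \<le> expo m x + expo m y}" for k
  have U: "monomial_set (U k)" for k
    by (auto simp: monomial_set_def U_def lookup_add)
  have gens: "supp f \<subseteq> U 1" if "f \<in> ideal_of (var ` {x, y})" for f :: "('v, 'k) mpoly"
    by (rule ideal_subset_monomial[OF U _ that])
      (auto simp: var_def monom_poly_def U_def lookup_single)
  have prods: "supp (\<Prod>i<k. f i) \<subseteq> U k" if "\<forall>i<k. f i \<in> ideal_of (var ` {x, y})"
    for f :: "nat \<Rightarrow> ('v, 'k) mpoly" and k
    using that
  proof (induction k)
    case (Suc k)
    have "a + b \<in> U (Suc k)" if "a \<in> supp (\<Prod>i<k. f i)" "b \<in> supp (f k)" for a b
      using Suc gens[of "f k"] that by (fastforce simp: U_def lookup_add)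
    then show ?case
      using keys_mult[of "\<Prod>i<k. f i" "f k"] by auto
  qed (simp add: U_def)
  have factor: "\<exists>f r. (\<forall>i<k. f i \<in> var ` {x, y}) \<and> (monom_poly m :: ('v, 'k) mpoly) = r * (\<Prod>i<k. f i)"
    if "m \<in> U k" for m k
    using that
  proof (induction k arbitrary: m)
    case (Suc k)
    then have "expo m x \<noteq> 0 \<or> expo m y \<noteq> 0"
      by (auto simp: U_def)
    then obtain z where z: "z \<in> {x, y}" "expo m z \<noteq> 0"
      by blast
    define m' where "m' = m - var_monom z"
    have m: "m = var_monom z + m'"
      using var_monom_plus_minus[OF z(2)] by (simp add: m'_def)
    have "m' \<in> U k"
      using Suc.prems assms z(1) unfolding m U_def
      by (auto simp: lookup_add lookup_single when_def split: if_splits)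
    from Suc.IH[OF this] obtain f r
      where f: "\<forall>i<k. f i \<in> var ` {x, y}" "(monom_poly m' :: ('v, 'k) mpoly) = r * (\<Prod>i<k. f i)"
      by blast
    have "(\<Prod>i<k. (f(k := var z)) i) = (\<Prod>i<k. f i)"
      by (intro prod.cong) auto
    then have "(monom_poly m :: ('v, 'k) mpoly) = r * (\<Prod>i<Suc k. (f(k := var z)) i)"
      unfolding m monom_poly_add f(2) by (simp add: var_def mult_ac)
    moreover have "\<forall>i<Suc k. (f(k := var z)) i \<in> var ` {x, y}"
      using f(1) z(1) by (auto simp: less_Suc_eq)
    ultimately show ?case
      by blast
  qed (auto intro!: exI[of _ "monom_poly _"])
  show ?thesis
  proof
    assume "p \<in> ideal_power (ideal_of (var ` {x, y})) k"
    then have "supp p \<subseteq> U k"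
      unfolding ideal_power_def by (rule ideal_subset_monomial[OF U, rotated]) (use prods in auto)
    then show "\<forall>m\<in>supp p. k \<le> expo m x + expo m y"
      by (auto simp: U_def)
  next
    assume p: "\<forall>m\<in>supp p. k \<le> expo m x + expo m y"
    show "p \<in> ideal_power (ideal_of (var ` {x, y})) k"
      unfolding ideal_power_def
    proof (rule monomial_subset_ideal)
      fix m assume "m \<in> supp p"
      with p obtain f r where f: "\<forall>i<k. f i \<in> var ` {x, y}" "(monom_poly m :: ('v, 'k) mpoly) = r * (\<Prod>i<k. f i)"
        using factor[of m k] by (auto simp: U_def)
      have "\<forall>i<k. f i \<in> ideal_of (var ` {x, y})"
        using f(1) by (blast intro: ideal_of_base)
      then show "(monom_poly m :: ('v, 'k) mpoly) \<in> ideal_of {\<Prod>i<k. f i | f. \<forall>i<k. f i \<in> ideal_of (var ` {x, y})}"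
        unfolding f(2) by (intro ideal_of_mult ideal_of_base) blast
    qed
  qed
qed

lemma cover_ideal_symbolic_power_eq:
  assumes "simple_graph E"
  shows "cover_ideal_symbolic_power E k = (polys_on (cover_monoms E k) :: ('v::finite, 'k::field) mpoly set)"
proof -
  have e: "p \<in> ideal_power (ideal_of (var ` {x, y})) k \<longleftrightarrow> (\<forall>m\<in>supp p. k \<le> expo m x + expo m y)"
    if "{x, y} \<in> E" for x y and p :: "('v, 'k) mpoly"
    using that simple_graph_no_loop[OF assms] by (intro ideal_power_edge) auto
  have "p \<in> cover_ideal_symbolic_power E k \<longleftrightarrow> (\<forall>x y. {x, y} \<in> E \<longrightarrow> p \<in> ideal_power (ideal_of (var ` {x, y})) k)"
    for p :: "('v, 'k) mpoly"
    unfolding cover_ideal_symbolic_power_def using simple_graph_edge[OF assms] by blast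
  moreover have "p \<in> polys_on (cover_monoms E k) \<longleftrightarrow> (\<forall>x y. {x, y} \<in> E \<longrightarrow> p \<in> ideal_power (ideal_of (var ` {x, y})) k)"
    for p :: "('v, 'k) mpoly"
    unfolding polys_on_def cover_monoms_def using e[of _ _ p] by blast
  ultimately show ?thesis
    by blast
qed

lemma cover_ideal_degree:
  fixes E :: "'v::finite set set"
  assumes E: "simple_graph E" and d: "\<And>C. minimal_vertex_cover E C \<Longrightarrow> card C = d"
  shows "monomial_ideal_degree (cover_ideal E :: ('v, 'k::field) mpoly set) = d"
proof -
  let ?M = "set_monom ` {C. minimal_vertex_cover E C}"
  have "(\<Prod>x\<in>C. var x :: ('v, 'k) mpoly) = monom_poly (set_monom C)" for C
    by (induction C rule: infinite_finite_induct)
      (auto simp: set_monom_insert monom_poly_add var_def, auto simp: monom_poly_def set_monom_def)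
  then have "{\<Prod>x\<in>C. var x :: ('v, 'k) mpoly | C. minimal_vertex_cover E C} = monom_poly ` ?M"
    by auto
  then have "ideal_of (monom_poly ` ?M) = (cover_ideal E :: ('v, 'k) mpoly set)"
    by (simp add: cover_ideal_def)
  then have gens: "minimal_monomial_generators (cover_ideal E :: ('v, 'k) mpoly set) = ?M"
  proof (rule minimal_monomial_generators_eq)
    fix m n r assume "m \<in> ?M" "n \<in> ?M" and mn: "m = n + r"
    then obtain C D where CD: "minimal_vertex_cover E C" "m = set_monom C"
      "minimal_vertex_cover E D" "n = set_monom D"
      by blast
    have "x \<in> C" if "x \<in> D" for x
      using arg_cong[OF mn, of "\<lambda>m. expo m x"] that
      by (auto simp: CD lookup_add expo_set_monom split: if_splits)
    with CD show "m = n"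
      unfolding minimal_vertex_cover_def by blast
  qed
  obtain C where "minimal_vertex_cover E C"
    using minimal_vertex_cover_exists[OF E] by blast
  then have "monom_degree ` ?M = {d}"
    using d by (force simp: image_image monom_degree_set_monom)
  then show ?thesis
    by (simp add: monomial_ideal_degree_def gens)
qed

text \<open>Each \<open>x\<close> in \<open>C\<close> has an edge to some \<open>y\<close> outside
  \<open>C\<close>. A divisor of \<open>m\<close> has exponent 0 at \<open>y\<close>, so being a
  \<open>k\<close>-cover forces exponent \<open>k\<close> at \<open>x\<close>.\<close>

lemma cover_monoms_minimal_generator:
  fixes E :: "'v::finite set set"
  assumes E: "simple_graph E" and C: "minimal_vertex_cover E C"
  obtains m where "m \<in> cover_monoms E k" "monom_degree m = k * card C"
    "\<And>t u. t \<in> cover_monoms E k \<Longrightarrow> m = t + u \<Longrightarrow> t = m"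
proof -
  define m where "m = (\<Sum>x\<in>C. Poly_Mapping.single x k)"
  have m: "expo m x = (if x \<in> C then k else 0)" for x
    by (simp add: m_def lookup_sum lookup_single when_def sum.delta')
  have "x \<in> C \<or> y \<in> C" if "{x, y} \<in> E" for x y
    using C that by (fastforce simp: minimal_vertex_cover_def vertex_cover_def)
  then have "m \<in> cover_monoms E k"
    by (fastforce simp: cover_monoms_def m)
  moreover have "monom_degree m = k * card C"
    by (simp add: monom_degree_def m sum.If_cases)
  moreover have "t = m" if t: "t \<in> cover_monoms E k" and tu: "m = t + u" for t u
  proof (rule poly_mapping_eqI)
    fix x
    have le: "expo t y \<le> expo m y" for y
      by (simp add: tu lookup_add)
    show "expo t x = expo m x"
    proof (cases "x \<in> C")
      case True
      then obtain y where y: "y \<notin> C" "{x, y} \<in> E"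
        using minimal_vertex_cover_private_edge[OF E C] by blast
      have "k \<le> expo t x + expo t y"
        using t y(2) by (simp add: cover_monoms_def)
      moreover have "expo t y = 0"
        using y(1) le[of y] by (simp add: m)
      ultimately have "k \<le> expo t x"
        by simp
      then show ?thesis
        using True le[of x] by (simp add: m)
    qed (use le[of x] in \<open>simp add: m\<close>)
  qed
  ultimately show thesis
    using that by blast
qed

text \<open>If \<open>x\<close> fails as a cone point, some face \<open>F\<close> of size
  \<open>p\<close> cannot be extended by \<open>x\<close>: either \<open>x\<close> has exponent 0,
  or \<open>b = a - F\<close> has a tight edge from \<open>x\<close> to some \<open>w\<close>. In
  \<open>a\<close> this edge has sum \<open>k\<close> if \<open>w\<close> is outside
  \<open>F\<close> and \<open>k + 1\<close> otherwise; in the latter case \<open>F\<close> is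
  nonempty and no edge at \<open>w\<close> is tight in \<open>a\<close>.\<close>

lemma cover_monoms_cone_point:
  fixes E :: "'v::finite set set"
  assumes E: "simple_graph E" and k: "1 \<le> k"
    and d: "\<And>L. max_independent_in E UNIV L \<Longrightarrow> card L + d = card (UNIV :: 'v set)"
    and deg: "monom_degree a > (k - 1) * d + (card (UNIV :: 'v set) - 1) + p"
  shows "\<exists>x. \<forall>F b. card F = p \<longrightarrow> a = b + set_monom F \<longrightarrow> b \<in> cover_monoms E k \<longrightarrow> x \<notin> F \<longrightarrow>
    expo b x \<noteq> 0 \<and> b - var_monom x \<in> cover_monoms E k"
proof (rule ccontr)
  let ?n = "card (UNIV :: 'v set)"
  assume "\<not> ?thesis"
  then have bad: "\<exists>F b. card F = p \<and> a = b + set_monom F \<and> b \<in> cover_monoms E k \<and> x \<notin> F \<and>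
      \<not> (expo b x \<noteq> 0 \<and> b - var_monom x \<in> cover_monoms E k)" for x
    by blast
  have cover: "k \<le> expo a x + expo a y" if "{x, y} \<in> E" for x y
  proof -
    obtain F b where "a = b + set_monom F" "b \<in> cover_monoms E k"
      using bad by blast
    then show ?thesis
      using that by (fastforce simp: cover_monoms_def lookup_add)
  qed
  have loose: "expo a x = 0 \<or> (\<exists>y. {x, y} \<in> E \<and> expo a x + expo a y = k) \<or>
      (p \<noteq> 0 \<and> (\<exists>y. {x, y} \<in> E \<and> expo a x + expo a y = Suc k \<and> 0 < expo a y \<and>
        (\<forall>z. {y, z} \<in> E \<longrightarrow> expo a y + expo a z \<noteq> k)))" for x
  proof -
    obtain F b where F: "card F = p" "a = b + set_monom F" "b \<in> cover_monoms E k" "x \<notin> F"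
      "\<not> (expo b x \<noteq> 0 \<and> b - var_monom x \<in> cover_monoms E k)"
      using bad by blast
    have a: "expo a y = expo b y + (if y \<in> F then 1 else 0)" for y
      by (simp add: F(2) lookup_add expo_set_monom)
    have b: "k \<le> expo b y + expo b z" if "{y, z} \<in> E" for y z
      using F(3) that by (simp add: cover_monoms_def)
    show ?thesis
    proof (cases "expo b x = 0")
      case True
      then show ?thesis
        using a[of x] F(4) by simp
    next
      case False
      with F(5) obtain y z where yz: "{y, z} \<in> E"
        "expo (b - var_monom x) y + expo (b - var_monom x) z < k"
        by (auto simp: cover_monoms_def not_le)
      have bx: "expo (b - var_monom x) w = (if w = x then expo b x - 1 else expo b w)" for w
        by (simp add: lookup_minus lookup_single when_def)
      have "y \<noteq> z"
        using yz(1) simple_graph_no_loop[OF E] by auto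
      have "y = x \<or> z = x"
        using yz(2) b[OF yz(1)] by (auto simp: bx simp del: One_nat_def split: if_splits)
      then obtain w where w: "{x, w} \<in> E" "w \<noteq> x" "expo b x - 1 + expo b w < k"
      proof
        assume "y = x"
        then show thesis
          using that[of z] yz \<open>y \<noteq> z\<close> by (simp add: bx del: One_nat_def)
      next
        assume "z = x"
        then show thesis
          using that[of y] yz \<open>y \<noteq> z\<close> by (simp add: bx insert_commute add.commute del: One_nat_def)
      qed
      then have bw: "expo b x + expo b w = k"
        using b[OF w(1)] False by simp
      show ?thesis
      proof (cases "w \<in> F")
        case False
        then show ?thesis
          using w(1) bw a[of x] a[of w] F(4) by auto
      next
        case True
        have "\<forall>z. {w, z} \<in> E \<longrightarrow> expo a w + expo a z \<noteq> k"
        proof (intro allI impI)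
          fix z assume "{w, z} \<in> E"
          from b[OF this] show "expo a w + expo a z \<noteq> k"
            using a[of w] a[of z] True by simp
        qed
        moreover have "p \<noteq> 0"
          using True F(1) by (metis card_eq_0_iff empty_iff finite)
        moreover have "expo a x + expo a w = Suc k" "0 < expo a w"
          using bw a[of x] a[of w] F(4) True by simp_all
        ultimately show ?thesis
          using w(1) by blast
      qed
    qed
  qed
  \<comment> \<open>Any vertex would do: a maximal independent set is nonempty, so minimal covers
    miss a vertex and \<open>d < ?n\<close>.\<close>
  obtain L where L: "undefined \<in> L" "max_independent_in E UNIV L"
    using max_independent_in_extend[OF E, of "{undefined}" UNIV] simple_graph_no_loop[OF E, of undefined]
    by (auto simp: independent_set_def)
  then have "0 < card L"
    by (auto simp: card_gt_0_iff)
  with d[OF L(2)] have dn: "d < ?n"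
    by simp
  have kd: "k * d = (k - 1) * d + d"
    using k by (cases k) auto
  have "sum (expo a) UNIV + d \<le> k * d + ?n"
  proof (rule no_cone_point_weight[OF E d cover])
    fix x
    show "expo a x = 0 \<or> (\<exists>y. {x, y} \<in> E \<and> expo a x + expo a y = k) \<or>
      (\<exists>y. {x, y} \<in> E \<and> expo a x + expo a y = Suc k \<and> 0 < expo a y \<and>
        (\<forall>z. {y, z} \<in> E \<longrightarrow> expo a y + expo a z \<noteq> k))"
      using loose[of x] by blast
  qed
  \<comment> \<open>The weight bound gives degree at most \<open>(k - 1) * d + ?n\<close>, while
    \<open>deg\<close> demands at least \<open>(k - 1) * d + ?n + p\<close>. For
    \<open>p = 0\<close> the loose alternative disappears, \<open>a\<close> itself is a minimal
    \<open>k\<close>-cover, and its weight \<open>k * d\<close> is too small because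
    \<open>d < ?n\<close>.\<close>
  then have "p = 0"
    using deg dn kd by (simp add: monom_degree_def)
  have "sum (expo a) UNIV \<le> k * d"
  proof (rule minimal_cover_weight[OF E d cover])
    fix x assume "0 < expo a x"
    then show "\<exists>y. {x, y} \<in> E \<and> expo a x + expo a y = k"
      using loose[of x] \<open>p = 0\<close> by simp
  qed
  then show False
    using deg dn kd by (simp add: monom_degree_def)
qed

theorem theorem3p6:
  fixes E :: "'v::finite set set" and k :: nat
  assumes "simple_graph E"
    and "unmixed E"
    and "k \<ge> 1"
  shows "int (k * monomial_ideal_degree (cover_ideal E :: ('v, 'k::field) mpoly set))
           \<le> regularity (cover_ideal_symbolic_power E k :: ('v, 'k) mpoly set)
       \<and> regularity (cover_ideal_symbolic_power E k :: ('v, 'k) mpoly set)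
           \<le> (int k - 1) * int (monomial_ideal_degree (cover_ideal E :: ('v, 'k) mpoly set))
             + int (card (UNIV :: 'v set)) - 1"
proof -
  let ?n = "card (UNIV :: 'v set)"
  let ?I = "polys_on (cover_monoms E k) :: ('v, 'k) mpoly set"
  obtain C where C: "minimal_vertex_cover E C"
    using minimal_vertex_cover_exists[OF assms(1)] by blast
  define d where "d = card C"
  have card_d: "card D = d" if "minimal_vertex_cover E D" for D
    using assms(2) C that unfolding unmixed_def d_def by blast
  have L: "card L + d = ?n" if "max_independent_in E UNIV L" for L
    using card_d[OF max_independent_complement[OF assms(1) that]] card_mono[of UNIV L]
    by (simp add: card_Diff_subset Compl_eq_Diff_UNIV)
  obtain m where m: "m \<in> cover_monoms E k" "monom_degree m = k * d"
    "\<And>t u. t \<in> cover_monoms E k \<Longrightarrow> m = t + u \<Longrightarrow> t = m"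
    using cover_monoms_minimal_generator[OF assms(1) C] unfolding d_def by blast
  have "int (k * d) \<le> regularity ?I \<and> regularity ?I \<le> int ((k - 1) * d + (?n - 1))"
  proof (rule regularity_bounds)
    show "graded_submodule [0] (ideal_vecs ?I)"
      by (rule graded_submodule_polys_on[OF monomial_set_cover_monoms])
    show "koszul_exact [0] (ideal_vecs ?I) p j" if "j > int ((k - 1) * d + (?n - 1)) + int p" for p j
    proof (rule koszul_exact_polys_on)
      fix a :: "'v monom" assume "int (monom_degree a) = j"
      with that have "int ((k - 1) * d + (?n - 1) + p) < int (monom_degree a)"
        by (simp only: of_nat_add)
      then show "\<exists>x. \<forall>F b. card F = p \<longrightarrow> a = b + set_monom F \<longrightarrow> b \<in> cover_monoms E k \<longrightarrow> x \<notin> F \<longrightarrow>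
          expo b x \<noteq> 0 \<and> b - var_monom x \<in> cover_monoms E k"
        by (intro cover_monoms_cone_point[OF assms(1,3) L]) (simp_all only: of_nat_less_iff)
    qed
    show "k * d \<in> set (s 0)" if "minimal_graded_free_resolution ?I s \<epsilon> \<phi>" for s \<epsilon> \<phi>
      using minimal_generator_degree[OF that m(1,3)] m(2) by simp
  qed
  \<comment> \<open>The truncated differences \<open>k - 1\<close> and \<open>?n - 1\<close> agree
    with the integer ones, since both numbers are positive.\<close>
  moreover have "0 < ?n"
    by (simp add: card_gt_0_iff)
  then have "int ((k - 1) * d + (?n - 1)) = (int k - 1) * int d + int ?n - 1"
    using assms(3) by (simp add: of_nat_diff)
  ultimately show ?thesis
    by (simp add: cover_ideal_symbolic_power_eq[OF assms(1)] cover_ideal_degree[OF assms(1) card_d])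
qed

end
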